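(* Suppose $r\in\mathbb{N}_0$ is even and $f\in C^{r+2}(\mathbb{R}^d)$. If $\Phi=\Phi(-\,\cdot\,)$ and $\nu\ge\widetilde\nu$, where $\widetilde\nu=\widetilde\nu(d,r)>0$ is the threshold constant described in the context, then there exists a constant $C=C(\Phi,d,m,r)>0$ such that the error $E_hf=f-Q_hf$ of the standard moving least-squares method satisfies $$|E_hf(x)|\le C\bigl(\nu^{1-m}\delta^{r+1}\,|f|_{W^{r+1,\infty}(B_\delta(x))}+\delta^{r+2}\,|f|_{W^{r+2,\infty}(B_\delta(x))}\bigr)$$ for all $x\in\mathbb{R}^d$. In particular, if $\nu^{-m}\le h$, this means $$|E_hf(x)|\le 2C\,\delta^{r+2}\,|f|_{W^{r+1,r+2,\infty}(B_\delta(x))}.$$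
   Context: Standing assumptions: $d,k,m\in\mathbb{N}$ and $r\in\mathbb{N}_0$ with $m>k>r$; $\Phi\in C^m(\mathbb{R}^d)$ is a non-negative, non-zero kernel with compact support in the unit ball; $\pi_r(\mathbb{R}^d)$ is the space of polynomials of degree at most $r$, with a basis $\mathcal{B}=\{p_1,\dots,p_M\}$, $M=\dim\pi_r(\mathbb{R}^d)$. Let $h>0$, $\nu>1$ and $\delta:=\nu h$. The shape matrix $A(x)\in\mathbb{R}^{M\times M}$ has entries $a_{ij}(x)=\sum_{q\in\mathbb{Z}^d}\Phi\bigl(\frac{x-hq}{\delta}\bigr)p_i\bigl(\frac{x-hq}{\delta}\bigr)p_j\bigl(\frac{x-hq}{\delta}\bigr)$. If $A(x)$ is positive definite for all $x$, put $\lambda(x)=A(x)^{-1}(p_1(0),\dots,p_M(0))^{\rm T}$ and define the weight function $w_\delta(y,x)=\Phi\bigl(\frac{x-y}{\delta}\bigr)\sum_{j=1}^M\lambda_j(x)p_j\bigl(\frac{x-y}{\delta}\bigr)$, which does not depend on the choice of basis. The moving least-squares approximant of $f:\mathbb{R}^d\to\mathbb{R}$ on the grid $h\mathbb{Z}^d$ is $Q_hf(x)=\sum_{q\in\mathbb{Z}^d}w_\delta(hq,x)f(hq)$, i.e. the value at $x$ of the minimizer over $p\in\pi_r(\mathbb{R}^d)$ of $\sum_{q\in\mathbb{Z}^d}\Phi\bigl(\frac{x-hq}{\delta}\bigr)|f(hq)-p(hq)|^2$. The constant $\widetilde\nu$ is the one provided by the following result: if $\Phi=\Phi(-\,\cdot\,)$,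 then there exist constants $\widetilde\nu=\widetilde\nu(d,r)>0$ and $C_\alpha=C_\alpha(\Phi,d,m,r)>0$ such that $\bigl|\sum_{q\in\mathbb{Z}^d}w_\delta(hq,x)(x-hq)^\alpha\bigr|\le C_\alpha\,\delta^{|\alpha|}\,\nu^{1-m}$, provided that $\nu\ge\widetilde\nu$ and $|\alpha|$ is odd. Seminorms: $B_\delta(x)$ is the open ball of radius $\delta$ about $x$; $|f|_{W^{n,\infty}(\Omega)}=\max_{|\alpha|=n}\|D^\alpha f\|_{L^\infty(\Omega)}$ and $|f|_{W^{j,n,\infty}(\Omega)}=\max_{j\le|\alpha|\le n}\|D^\alpha f\|_{L^\infty(\Omega)}$. *)

theory Defs
  imports "HOL-Analysis.Analysis" "HOL-Probability.Essential_Supremum"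
begin

definition mi_size :: "('d::finite \<Rightarrow> nat) \<Rightarrow> nat" where
  "mi_size \<alpha> = (\<Sum>i\<in>UNIV. \<alpha> i)"

definition mi_power :: "('d::finite \<Rightarrow> nat) \<Rightarrow> real^'d \<Rightarrow> real" where
  "mi_power \<alpha> x = (\<Prod>i\<in>UNIV. (x $ i) ^ \<alpha> i)"

definition polys :: "nat \<Rightarrow> (real^'d::finite \<Rightarrow> real) set" where
  "polys r = {s. \<exists>c. s = (\<lambda>x. \<Sum>\<alpha> | mi_size \<alpha> \<le> r. c \<alpha> * mi_power \<alpha> x)}"

text \<open>A basis of \<^term>\<open>polys r\<close> is a family indexed by a finite type \<open>'b\<close>; being a basis
  forces \<open>CARD('b)\<close> to be the dimension \<open>M\<close> of the polynomial space.\<close>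

definition poly_basis :: "nat \<Rightarrow> ('b::finite \<Rightarrow> real^'d::finite \<Rightarrow> real) \<Rightarrow> bool" where
  "poly_basis r p \<longleftrightarrow>
     (\<forall>j. p j \<in> polys r) \<and>
     (\<forall>c. (\<forall>x. (\<Sum>j\<in>UNIV. c j * p j x) = 0) \<longrightarrow> (\<forall>j. c j = 0)) \<and>
     (\<forall>s\<in>polys r. \<exists>c. s = (\<lambda>x. \<Sum>j\<in>UNIV. c j * p j x))"

definition partial_deriv :: "'d::finite \<Rightarrow> (real^'d \<Rightarrow> real) \<Rightarrow> real^'d \<Rightarrow> real" where
  "partial_deriv i f x = deriv (\<lambda>t. f (x + t *\<^sub>R axis i 1)) 0"

primrec C_k :: "nat \<Rightarrow> (real^'d::finite \<Rightarrow> real) \<Rightarrow> bool" where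
  "C_k 0 f \<longleftrightarrow> continuous_on UNIV f"
| "C_k (Suc n) f \<longleftrightarrow> f differentiable_on UNIV \<and> (\<forall>i. C_k n (partial_deriv i f))"

text \<open>\<open>D\<^sup>\<alpha> f\<close>: the differentiations are carried out along some list of coordinates in which
  each \<open>i\<close> occurs \<open>\<alpha> i\<close> times. For functions of class \<open>C\<^sup>n\<close> with \<open>n \<ge> \<bar>\<alpha>\<bar>\<close>, the only ones
  to which it is applied, the order is immaterial by symmetry of partial derivatives.\<close>

definition mi_deriv :: "('d::finite \<Rightarrow> nat) \<Rightarrow> (real^'d \<Rightarrow> real) \<Rightarrow> real^'d \<Rightarrow> real" where
  "mi_deriv \<alpha> f = foldr partial_deriv (SOME is. \<forall>i. count_list is i = \<alpha> i) f"

definition Linf_norm :: "(real^'d::finite) set \<Rightarrow> (real^'d \<Rightarrow> real) \<Rightarrow> ereal" where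
  "Linf_norm \<Omega> g = esssup (lebesgue_on \<Omega>) (\<lambda>y. ereal \<bar>g y\<bar>)"

definition W_seminorm2 :: "nat \<Rightarrow> nat \<Rightarrow> (real^'d::finite) set \<Rightarrow> (real^'d \<Rightarrow> real) \<Rightarrow> ereal" where
  "W_seminorm2 j n \<Omega> f = Max ((\<lambda>\<alpha>. Linf_norm \<Omega> (mi_deriv \<alpha> f)) ` {\<alpha>. j \<le> mi_size \<alpha> \<and> mi_size \<alpha> \<le> n})"

definition W_seminorm :: "nat \<Rightarrow> (real^'d::finite) set \<Rightarrow> (real^'d \<Rightarrow> real) \<Rightarrow> ereal" where
  "W_seminorm n \<Omega> f = Max ((\<lambda>\<alpha>. Linf_norm \<Omega> (mi_deriv \<alpha> f)) ` {\<alpha>. mi_size \<alpha> = n})"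

text \<open>The support is a subset of the \<^emph>\<open>closed\<close> unit ball, so that kernels that are positive on the
  whole open unit ball are allowed; compactness of the support follows.\<close>

definition mls_kernel :: "nat \<Rightarrow> (real^'d::finite \<Rightarrow> real) \<Rightarrow> bool" where
  "mls_kernel m \<Phi> \<longleftrightarrow>
     C_k m \<Phi> \<and> (\<forall>x. 0 \<le> \<Phi> x) \<and> (\<exists>x. \<Phi> x \<noteq> 0) \<and> closure {x. \<Phi> x \<noteq> 0} \<subseteq> cball 0 1"

definition grid_pt :: "real \<Rightarrow> int^'d::finite \<Rightarrow> real^'d" where
  "grid_pt h q = (\<chi> i. h * real_of_int (q $ i))"

text \<open>All sums over the grid below have only finitely many non-zero terms, because \<open>\<Phi>\<close> has
  compact support; for them \<open>infsum\<close> is the ordinary finite sum.\<close>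

definition shape_matrix ::
  "(real^'d::finite \<Rightarrow> real) \<Rightarrow> ('b::finite \<Rightarrow> real^'d \<Rightarrow> real) \<Rightarrow> real \<Rightarrow> real \<Rightarrow> real^'d \<Rightarrow> real^'b^'b" where
  "shape_matrix \<Phi> p h \<delta> x = (\<chi> i j. \<Sum>\<^sub>\<infinity>q\<in>UNIV.
     \<Phi> ((x - grid_pt h q) /\<^sub>R \<delta>) * p i ((x - grid_pt h q) /\<^sub>R \<delta>) * p j ((x - grid_pt h q) /\<^sub>R \<delta>))"

definition positive_definite :: "real^'b^'b::finite \<Rightarrow> bool" where
  "positive_definite A \<longleftrightarrow> transpose A = A \<and> (\<forall>v. v \<noteq> 0 \<longrightarrow> 0 < v \<bullet> (A *v v))"

definition mls_coeff ::
  "(real^'d::finite \<Rightarrow> real) \<Rightarrow> ('b::finite \<Rightarrow> real^'d \<Rightarrow> real) \<Rightarrow> real \<Rightarrow> real \<Rightarrow> real^'d \<Rightarrow> real^'b" where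
  "mls_coeff \<Phi> p h \<delta> x = matrix_inv (shape_matrix \<Phi> p h \<delta> x) *v (\<chi> j. p j 0)"

definition mls_weight ::
  "(real^'d::finite \<Rightarrow> real) \<Rightarrow> ('b::finite \<Rightarrow> real^'d \<Rightarrow> real) \<Rightarrow> real \<Rightarrow> real \<Rightarrow> real^'d \<Rightarrow> real^'d \<Rightarrow> real" where
  "mls_weight \<Phi> p h \<delta> y x =
     \<Phi> ((x - y) /\<^sub>R \<delta>) * (\<Sum>j\<in>UNIV. mls_coeff \<Phi> p h \<delta> x $ j * p j ((x - y) /\<^sub>R \<delta>))"

definition mls_approx ::
  "(real^'d::finite \<Rightarrow> real) \<Rightarrow> ('b::finite \<Rightarrow> real^'d \<Rightarrow> real) \<Rightarrow> real \<Rightarrow> real \<Rightarrow>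
   (real^'d \<Rightarrow> real) \<Rightarrow> real^'d \<Rightarrow> real" where
  "mls_approx \<Phi> p h \<delta> f x = (\<Sum>\<^sub>\<infinity>q\<in>UNIV. mls_weight \<Phi> p h \<delta> (grid_pt h q) x * f (grid_pt h q))"

definition mls_error ::
  "(real^'d::finite \<Rightarrow> real) \<Rightarrow> ('b::finite \<Rightarrow> real^'d \<Rightarrow> real) \<Rightarrow> real \<Rightarrow> real \<Rightarrow>
   (real^'d \<Rightarrow> real) \<Rightarrow> real^'d \<Rightarrow> real" where
  "mls_error \<Phi> p h \<delta> f x = f x - mls_approx \<Phi> p h \<delta> f x"

text \<open>The threshold \<open>\<nu>\<^sub>0(d, r)\<close> of the odd-moment estimate. It depends on nothing but \<open>d\<close> and \<open>r\<close>,
  so the kernel is quantified inside; the constant \<open>C\<close> (called \<open>C\<^sub>\<alpha>\<close> in the literature) may depend on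
  \<open>\<Phi>\<close>, \<open>m\<close> and \<open>\<alpha>\<close>, but not on \<open>h\<close>, \<open>\<nu>\<close>, \<open>x\<close> or the basis. The weights only make sense if all
  shape matrices are positive definite, which is no consequence of \<open>\<nu>\<close> being large relative to
  \<open>d\<close> and \<open>r\<close>, as the support of \<open>\<Phi>\<close> may be arbitrarily small. The \<open>itself\<close> arguments fix the
  dimension \<open>d = CARD('d)\<close> and the index type \<open>'b\<close> of the bases.\<close>

definition odd_moment_threshold :: "'d::finite itself \<Rightarrow> 'b::finite itself \<Rightarrow> nat \<Rightarrow> real \<Rightarrow> bool" where
  "odd_moment_threshold _ _ r \<nu>\<^sub>0 \<longleftrightarrow>
     0 < \<nu>\<^sub>0 \<and>
     (\<forall>(\<Phi> :: real^'d \<Rightarrow> real) m k \<alpha>.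
        r < k \<longrightarrow> k < m \<longrightarrow> mls_kernel m \<Phi> \<longrightarrow> (\<forall>x. \<Phi> (- x) = \<Phi> x) \<longrightarrow> odd (mi_size \<alpha>) \<longrightarrow>
        (\<exists>C>0. \<forall>(p :: 'b \<Rightarrow> real^'d \<Rightarrow> real) h \<nu>.
           poly_basis r p \<longrightarrow> 0 < h \<longrightarrow> 1 < \<nu> \<longrightarrow> \<nu>\<^sub>0 \<le> \<nu> \<longrightarrow>
           (\<forall>x. positive_definite (shape_matrix \<Phi> p h (\<nu> * h) x)) \<longrightarrow>
           (\<forall>x. \<bar>\<Sum>\<^sub>\<infinity>q\<in>UNIV. mls_weight \<Phi> p h (\<nu> * h) (grid_pt h q) x * mi_power \<alpha> (x - grid_pt h q)\<bar>
                 \<le> C * (\<nu> * h) ^ mi_size \<alpha> * \<nu> powi (1 - int m))))"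

end

theory Submission
  imports Defs "HOL-Computational_Algebra.Polynomial"
begin

text \<open>Taylor's formula along the segment from \<open>x\<close> to a grid point \<open>y\<close> splits \<open>f y\<close> into a
  polynomial of degree at most \<open>r\<close> in \<open>y\<close>, a homogeneous part of degree \<open>r + 1\<close> and a remainder of
  size \<open>\<delta> ^ (r + 2)\<close>. The weights reproduce polynomials of degree at most \<open>r\<close> at \<open>x\<close>
  (\<open>mls_weights_reproducing\<close>), so the first part contributes exactly \<open>f x\<close>. The second part is a
  combination of moments of order \<open>r + 1\<close>; this number is odd, and the odd-moment estimate supplies
  the gain \<open>\<nu> powi (1 - m)\<close>. The remainder is controlled by the Lebesgue constant
  \<open>\<Sum>q. \<bar>w\<^sub>\<delta>(hq, x)\<bar>\<close>. The two estimates are combined in \<open>mls_error_bound\<close>.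

  The core is that the Lebesgue constant is bounded by a number depending only on the kernel and on
  \<open>r\<close> (\<open>lebesgue_constant_bounded\<close>). This is delicate because positive definiteness is
  only assumed for the given ratio \<open>\<nu>\<close>: the smallest eigenvalue of the shape matrix may
  tend to zero as \<open>\<nu>\<close> approaches a value at which definiteness breaks down. Two regimes
  are treated separately.

  For \<open>\<nu> \<le> N\<close> the grid points near \<open>x\<close> form, up to translation, a subset of a fixed finite set. A
  weight is a non-negative kernel value times a polynomial \<open>s\<close>, so it has the sign of \<open>s\<close>. If \<open>g\<close> is
  any polynomial with the same signs as \<open>s\<close> on the finite set, then reproduction gives
  \<open>\<Sum>q. \<bar>w q\<bar> * \<bar>g q\<bar> = \<Sum>q. w q * g q = g x\<close>, a bound for \<open>\<Sum>q. \<bar>w q\<bar>\<close> in terms of \<open>g\<close> alone. Only finitely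
  many sign patterns occur, and one representative \<open>g\<close> for each of them suffices
  (\<open>reproducing_weights_bounded_by_sign_patterns\<close>). No eigenvalue enters.

  For \<open>\<nu> \<ge> N\<close> the grid is fine relative to the kernel. By compactness of the sphere of normalized
  polynomials there is a ball of fixed radius on which \<open>\<Phi> * s\<^sup>2\<close> is large
  (\<open>kernel_weighted_square_uniformly_positive\<close>), and it contains of the order of \<open>\<nu> ^ d\<close> grid points.
  Testing reproduction with \<open>s\<close> itself bounds \<open>\<Sum>q. \<Phi> * s\<^sup>2\<close> by a multiple of the norm of \<open>s\<close>; hence this
  norm is of order \<open>\<nu> ^ (- d)\<close>, which compensates the number of summands.\<close>

section \<open>Polynomials of bounded total degree\<close>

lemma finite_multiindices_le: "finite {\<alpha> :: 'd::finite \<Rightarrow> nat. mi_size \<alpha> \<le> n}"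
proof (rule finite_subset)
  show "{\<alpha> :: 'd \<Rightarrow> nat. mi_size \<alpha> \<le> n} \<subseteq> PiE UNIV (\<lambda>_. {..n})"
    by (auto simp: mi_size_def PiE_iff intro: order_trans[OF member_le_sum[of _ UNIV]])
qed (simp add: finite_PiE)

lemma mi_power_add: "mi_power (\<lambda>i. \<alpha> i + \<beta> i) x = mi_power \<alpha> x * mi_power \<beta> x"
  by (simp add: mi_power_def power_add prod.distrib)

lemma mi_size_add: "mi_size (\<lambda>i. \<alpha> i + \<beta> i) = mi_size \<alpha> + mi_size \<beta>"
  by (simp add: mi_size_def sum.distrib)

lemma polys_add: "s \<in> polys r \<Longrightarrow> t \<in> polys r \<Longrightarrow> (\<lambda>x. s x + t x) \<in> polys r"
  unfolding polys_def by (auto simp: sum.distrib[symmetric] distrib_right[symmetric])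

lemma polys_cmult: 
  assumes "s \<in> polys r" shows "(\<lambda>x. a * s x) \<in> polys r"
proof -
  obtain c where "s = (\<lambda>x. \<Sum>\<alpha> | mi_size \<alpha> \<le> r. c \<alpha> * mi_power \<alpha> x)"
    using assms unfolding polys_def by auto
  hence "(\<lambda>x. a * s x) = (\<lambda>x. \<Sum>\<alpha> | mi_size \<alpha> \<le> r. (a * c \<alpha>) * mi_power \<alpha> x)"
    by (simp add: sum_distrib_left mult.assoc)
  thus ?thesis unfolding polys_def by (auto intro!: exI[of _ "\<lambda>\<alpha>. a * c \<alpha>"])
qed

lemma polys_zero: "(\<lambda>x. 0) \<in> polys r"
  unfolding polys_def by (auto intro!: exI[of _ "\<lambda>_. 0"])

lemma polys_sum: "(\<And>i. i \<in> I \<Longrightarrow> s i \<in> polys r) \<Longrightarrow> (\<lambda>x. \<Sum>i\<in>I. s i x) \<in> polys r"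
  by (induction I rule: infinite_finite_induct) (auto simp: polys_zero intro: polys_add)

lemma mi_power_in_polys:
  fixes \<alpha> :: "'d::finite \<Rightarrow> nat"
  assumes "mi_size \<alpha> \<le> r" shows "mi_power \<alpha> \<in> polys r"
proof -
  have "mi_power \<alpha> = (\<lambda>x. \<Sum>\<beta> | mi_size \<beta> \<le> r. (if \<beta> = \<alpha> then 1 else 0) * mi_power \<beta> x)"
  proof
    fix x :: "real^'d"
    have "(\<Sum>\<beta> | mi_size \<beta> \<le> r. (if \<beta> = \<alpha> then 1 else 0) * mi_power \<beta> x)
        = (\<Sum>\<beta> | mi_size \<beta> \<le> r. if \<beta> = \<alpha> then mi_power \<beta> x else 0)"
      by (intro sum.cong) auto
    also have "\<dots> = mi_power \<alpha> x"
      using assms by (simp add: sum.delta[OF finite_multiindices_le])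
    finally show "mi_power \<alpha> x = (\<Sum>\<beta> | mi_size \<beta> \<le> r. (if \<beta> = \<alpha> then 1 else 0) * mi_power \<beta> x)" ..
  qed
  thus ?thesis unfolding polys_def by (auto intro!: exI[of _ "\<lambda>\<beta>. if \<beta> = \<alpha> then 1 else 0"])
qed

lemma polys_mono:
  assumes "s \<in> polys m" "m \<le> n" shows "s \<in> polys n"
proof -
  obtain c where s: "s = (\<lambda>x. \<Sum>\<alpha> | mi_size \<alpha> \<le> m. c \<alpha> * mi_power \<alpha> x)"
    using assms unfolding polys_def by auto
  show ?thesis unfolding s
    using assms(2) by (intro polys_sum polys_cmult mi_power_in_polys) auto
qed

lemma polys_mult:
  assumes "s \<in> polys m" "t \<in> polys n" shows "(\<lambda>x. s x * t x) \<in> polys (m + n)"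
proof -
  obtain c d where s: "s = (\<lambda>x. \<Sum>\<alpha> | mi_size \<alpha> \<le> m. c \<alpha> * mi_power \<alpha> x)"
    and t: "t = (\<lambda>x. \<Sum>\<alpha> | mi_size \<alpha> \<le> n. d \<alpha> * mi_power \<alpha> x)"
    using assms unfolding polys_def by auto
  have "(\<lambda>x. s x * t x) = (\<lambda>x. \<Sum>\<alpha> | mi_size \<alpha> \<le> m. \<Sum>\<beta> | mi_size \<beta> \<le> n.
            (c \<alpha> * d \<beta>) * mi_power (\<lambda>i. \<alpha> i + \<beta> i) x)"
    by (simp add: s t sum_product mi_power_add algebra_simps)
  also have "\<dots> \<in> polys (m + n)"
    by (intro polys_sum polys_cmult mi_power_in_polys) (auto simp: mi_size_add)
  finally show ?thesis .
qed

lemma polys_const: "(\<lambda>x. a) \<in> polys r"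
proof -
  have "(\<lambda>x. a * mi_power (\<lambda>_. 0) x) \<in> polys r"
    by (intro polys_cmult mi_power_in_polys) (simp add: mi_size_def)
  thus ?thesis by (simp add: mi_power_def)
qed

lemma polys_component: "(\<lambda>x. x $ i) \<in> polys 1"
proof -
  have "(\<Prod>j\<in>UNIV. (x $ j) ^ (if j = i then 1 else 0)) = (\<Prod>j\<in>UNIV. if j = i then x $ j else 1)"
    for x :: "real^'a" by (intro prod.cong) auto
  hence "mi_power (\<lambda>j. if j = i then 1 else 0) = (\<lambda>x. x $ i)"
    by (auto simp: mi_power_def)
  moreover have "mi_power (\<lambda>j. if j = i then 1 else 0) \<in> polys 1"
    by (intro mi_power_in_polys) (simp add: mi_size_def)
  ultimately show ?thesis by simp
qed

lemma polys_power: "s \<in> polys m \<Longrightarrow> (\<lambda>x. s x ^ n) \<in> polys (m * n)"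
  by (induction n) (auto simp: polys_const dest: polys_mult)

lemma polys_prod:
  "finite I \<Longrightarrow> (\<And>i. i \<in> I \<Longrightarrow> s i \<in> polys (n i)) \<Longrightarrow> (\<lambda>x. \<Prod>i\<in>I. s i x) \<in> polys (\<Sum>i\<in>I. n i)"
  by (induction I rule: finite_induct) (auto simp: polys_const intro: polys_mult)

text \<open>The space does not depend on the choice of origin and unit of length. This allows one to pass
  freely between the scaled variable \<open>(x - hq) / \<delta>\<close> of the kernel and the grid variable \<open>q\<close>.\<close>

lemma polys_affine:
  fixes s :: "real^'d::finite \<Rightarrow> real"
  assumes "s \<in> polys r" shows "(\<lambda>z. s (a + b *\<^sub>R z)) \<in> polys r"
proof -
  obtain c where s: "s = (\<lambda>x. \<Sum>\<alpha> | mi_size \<alpha> \<le> r. c \<alpha> * mi_power \<alpha> x)"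
    using assms unfolding polys_def by auto
  have lin: "(\<lambda>z::real^'d. a $ i + b * z $ i) \<in> polys 1" for i
    by (intro polys_add polys_const polys_cmult polys_component)
  have "(\<lambda>z. \<Prod>i\<in>UNIV. (a $ i + b * z $ i) ^ \<alpha> i) \<in> polys (mi_size \<alpha>)" for \<alpha>
    unfolding mi_size_def using polys_power[OF lin] by (intro polys_prod) auto
  hence "(\<lambda>z. mi_power \<alpha> (a + b *\<^sub>R z)) \<in> polys r" if "mi_size \<alpha> \<le> r" for \<alpha>
    using that polys_mono unfolding mi_power_def by fastforce
  thus ?thesis unfolding s by (intro polys_sum polys_cmult) auto
qed

lemma continuous_on_mi_power: "continuous_on S (mi_power \<alpha>)"
  unfolding mi_power_def by (intro continuous_intros)

lemma continuous_on_polys: "s \<in> polys r \<Longrightarrow> continuous_on S s"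
  unfolding polys_def by (auto intro!: continuous_intros continuous_on_mi_power)

lemma polys_on_line:
  fixes s :: "real^'d::finite \<Rightarrow> real"
  assumes "s \<in> polys r" obtains P :: "real poly" where "\<And>t. poly P t = s (a + t *\<^sub>R v)"
proof -
  obtain c where s: "s = (\<lambda>x. \<Sum>\<alpha> | mi_size \<alpha> \<le> r. c \<alpha> * mi_power \<alpha> x)"
    using assms unfolding polys_def by auto
  show ?thesis
    by (rule that[of "\<Sum>\<alpha> | mi_size \<alpha> \<le> r. Polynomial.smult (c \<alpha>) (\<Prod>i\<in>UNIV. [:a $ i, v $ i:] ^ \<alpha> i)"])
      (simp add: s poly_sum poly_prod mi_power_def)
qed

text \<open>On each line through the centre of the ball, \<open>s\<close> is a univariate polynomial with infinitely many
  roots.\<close>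

lemma polys_zero_on_ball:
  fixes s :: "real^'d::finite \<Rightarrow> real"
  assumes "s \<in> polys r" "e > 0" and zero: "\<And>z. z \<in> ball u e \<Longrightarrow> s z = 0"
  shows "s x = 0"
proof -
  obtain P where P: "\<And>t. poly P t = s (u + t *\<^sub>R (x - u))"
    using polys_on_line[OF assms(1)] by blast
  define l where "l = e / (norm (x - u) + 1)"
  have "l > 0" using assms by (simp add: l_def add_nonneg_pos)
  have "poly P t = 0" if "t \<in> {0<..<l}" for t
  proof -
    have "norm (t *\<^sub>R (x - u)) \<le> t * (norm (x - u) + 1)" using that by (simp add: mult_left_mono)
    also have "\<dots> < l * (norm (x - u) + 1)"
      using that by (intro mult_strict_right_mono) (auto simp: add_nonneg_pos)
    also have "\<dots> = e" by (simp add: l_def add_nonneg_eq_0_iff)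
    finally have "norm (t *\<^sub>R (x - u)) < e" .
    hence "dist u (u + t *\<^sub>R (x - u)) < e" by (simp only: dist_norm) simp
    thus ?thesis unfolding P by (intro zero) simp
  qed
  hence "{0<..<l} \<subseteq> {t. poly P t = 0}" by auto
  moreover have "infinite {0<..<l}" using \<open>l > 0\<close> by (simp add: infinite_Ioo)
  ultimately have "P = 0" using poly_roots_finite finite_subset by blast
  with P[of 1] show ?thesis by simp
qed

lemma poly_basis_expansion:
  "poly_basis r p \<Longrightarrow> g \<in> polys r \<Longrightarrow> \<exists>c. g = (\<lambda>z. \<Sum>j\<in>UNIV. c j * p j z)"
  by (simp add: poly_basis_def)

section \<open>Reproducing weights and sign patterns\<close>

text \<open>The function \<open>c\<close> is arbitrary apart from its sign, and the bound does not see it: only the signs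
  of \<open>s\<close> on \<open>F\<close> matter, and there are finitely many possibilities for them. If \<open>g \<in> V\<close> has the signs of
  \<open>s\<close>, then all terms of \<open>\<Sum>q\<in>A. c q * s q * g q = g t\<close> are non-negative, whence
  \<open>(\<Sum>q\<in>A. \<bar>c q * s q\<bar>) * \<mu> \<le> sup \<bar>g\<bar>\<close>, where \<open>\<mu>\<close> is the least non-zero value of \<open>\<bar>g\<bar>\<close> on \<open>F\<close>. Terms with
  \<open>g q = 0\<close> have \<open>s q = 0\<close> and do not count.\<close>

lemma reproducing_weights_bounded_by_sign_patterns:
  fixes V :: "('a \<Rightarrow> real) set"
  assumes finF: "finite F" and bdd: "\<And>g. g \<in> V \<Longrightarrow> bounded (g ` K)"
  obtains L where "\<And>A c s t. A \<subseteq> F \<Longrightarrow> s \<in> V \<Longrightarrow> t \<in> K \<Longrightarrow> (\<And>q. q \<in> A \<Longrightarrow> 0 \<le> c q) \<Longrightarrow>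
     (\<And>g. g \<in> V \<Longrightarrow> (\<Sum>q\<in>A. c q * s q * g q) = g t) \<Longrightarrow> (\<Sum>q\<in>A. \<bar>c q * s q\<bar>) \<le> L"
proof -
  define hyp where "hyp A c s t \<longleftrightarrow> A \<subseteq> F \<and> s \<in> V \<and> t \<in> K \<and> (\<forall>q\<in>A. 0 \<le> c q) \<and>
     (\<forall>g\<in>V. (\<Sum>q\<in>A. c q * s q * g q) = g t)" for A and c s :: "'a \<Rightarrow> real" and t
  define bnd where "bnd g l \<longleftrightarrow> 0 \<le> l \<and> (\<forall>A c s t. hyp A c s t \<longrightarrow>
     (\<forall>q\<in>F. sgn (s q) = sgn (g q)) \<longrightarrow> (\<Sum>q\<in>A. \<bar>c q * s q\<bar>) \<le> l)" for g :: "'a \<Rightarrow> real" and l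
  have "\<exists>l. bnd g l" if g: "g \<in> V" for g
  proof -
    from bdd[OF g] obtain b where b: "\<And>t. t \<in> K \<Longrightarrow> \<bar>g t\<bar> \<le> b"
      unfolding bounded_iff by auto
    \<comment> \<open>The element \<open>1\<close> keeps the set non-empty when \<open>g\<close> vanishes on all of \<open>F\<close>.\<close>
    define \<mu> where "\<mu> = Min (insert 1 ((\<lambda>q. \<bar>g q\<bar>) ` {q\<in>F. g q \<noteq> 0}))"
    have \<mu>: "\<mu> > 0" unfolding \<mu>_def using finF by (subst Min_gr_iff) auto
    have \<mu>_le: "\<mu> \<le> \<bar>g q\<bar>" if "q \<in> F" "g q \<noteq> 0" for q
      unfolding \<mu>_def using finF that by (intro Min_le) auto
    have "(\<Sum>q\<in>A. \<bar>c q * s q\<bar>) \<le> \<bar>b\<bar> / \<mu>"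
      if h: "hyp A c s t" and sg: "\<forall>q\<in>F. sgn (s q) = sgn (g q)" for A c s t
    proof -
      have A: "A \<subseteq> F" and tK: "t \<in> K" and c: "\<And>q. q \<in> A \<Longrightarrow> 0 \<le> c q"
        and rep: "(\<Sum>q\<in>A. c q * s q * g q) = g t" using h g unfolding hyp_def by auto
      have "(\<Sum>q\<in>A. \<bar>c q * s q\<bar>) * \<mu> \<le> (\<Sum>q\<in>A. c q * s q * g q)"
        unfolding sum_distrib_right
      proof (rule sum_mono)
        fix q assume q: "q \<in> A"
        have sq: "sgn (s q) = sgn (g q)" using sg A q by auto
        show "\<bar>c q * s q\<bar> * \<mu> \<le> c q * s q * g q"
        proof (cases "s q = 0")
          case False
          with sq have g0: "g q \<noteq> 0" by (auto simp: sgn_zero_iff)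
          have "\<bar>c q * s q\<bar> * \<mu> \<le> \<bar>c q * s q\<bar> * \<bar>g q\<bar>"
            using \<mu>_le[of q] A q g0 by (intro mult_left_mono) auto
          also have "\<dots> = c q * (\<bar>s q\<bar> * \<bar>g q\<bar>)" using c[OF q] by (simp add: abs_mult)
          also have "\<bar>s q\<bar> * \<bar>g q\<bar> = s q * g q"
            using sq by (auto simp: sgn_if abs_if split: if_splits)
          finally show ?thesis by (simp add: mult.assoc)
        qed simp
      qed
      also have "\<dots> \<le> \<bar>b\<bar>" unfolding rep using b[OF tK] by linarith
      finally show ?thesis using \<mu> by (simp add: field_simps)
    qed
    hence "bnd g (\<bar>b\<bar> / \<mu>)" using \<mu> unfolding bnd_def by auto
    thus ?thesis ..
  qed
  hence "\<exists>l. \<forall>g\<in>V. bnd g (l g)" by (intro bchoice) blast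
  then obtain l where l: "\<And>g. g \<in> V \<Longrightarrow> bnd g (l g)" by blast
  define pat where "pat g = (\<lambda>q\<in>F. sgn (g q))" for g :: "'a \<Rightarrow> real"
  have fin: "finite (pat ` V)"
  proof (rule finite_subset)
    show "pat ` V \<subseteq> PiE F (\<lambda>_. {-1, 0, 1})" by (auto simp: pat_def sgn_if split: if_splits)
  qed (use finF in \<open>simp add: finite_PiE\<close>)
  \<comment> \<open>One representative per sign pattern turns the infinitely many bounds \<open>l g\<close> into a finite sum.\<close>
  define rep where "rep = inv_into V pat"
  have rep: "rep \<sigma> \<in> V" "pat (rep \<sigma>) = \<sigma>" if "\<sigma> \<in> pat ` V" for \<sigma>
    using that by (simp_all add: rep_def inv_into_into f_inv_into_f)
  show ?thesis
  proof (rule that[of "\<Sum>\<sigma>\<in>pat ` V. l (rep \<sigma>)"])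
    fix A c s t
    assume as: "A \<subseteq> F" "s \<in> V" "t \<in> K" "\<And>q. q \<in> A \<Longrightarrow> 0 \<le> c q"
      "\<And>g. g \<in> V \<Longrightarrow> (\<Sum>q\<in>A. c q * s q * g q) = g t"
    let ?g = "rep (pat s)"
    have \<sigma>: "pat s \<in> pat ` V" using as by auto
    have "pat s q = pat ?g q" for q using rep(2)[OF \<sigma>] by simp
    hence "sgn (s q) = sgn (?g q)" if "q \<in> F" for q using that unfolding pat_def restrict_def by metis
    hence "\<forall>q\<in>F. sgn (s q) = sgn (?g q)" by blast
    moreover have "hyp A c s t" using as by (auto simp: hyp_def)
    ultimately have "(\<Sum>q\<in>A. \<bar>c q * s q\<bar>) \<le> l ?g"
      using l[OF rep(1)[OF \<sigma>]] unfolding bnd_def by blast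
    also have "\<dots> \<le> (\<Sum>\<sigma>\<in>pat ` V. l (rep \<sigma>))"
      using fin \<sigma> l rep(1) by (intro member_le_sum) (auto simp: bnd_def)
    finally show "(\<Sum>q\<in>A. \<bar>c q * s q\<bar>) \<le> (\<Sum>\<sigma>\<in>pat ` V. l (rep \<sigma>))" .
  qed
qed

section \<open>Counting grid points near a point\<close>

text \<open>With \<open>y = x / h\<close> this is the scaled node \<open>(x - hq) / \<delta>\<close>. Writing it in terms of \<open>y\<close> and the ratio
  \<open>\<nu> = \<delta> / h\<close> shows that the weights depend on \<open>h\<close> only through these two quantities.\<close>

definition rel_node :: "real \<Rightarrow> real^'d::finite \<Rightarrow> int^'d \<Rightarrow> real^'d" where
  "rel_node \<nu> y q = (y - grid_pt 1 q) /\<^sub>R \<nu>"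

definition active :: "(real^'d::finite \<Rightarrow> real) \<Rightarrow> real \<Rightarrow> real^'d \<Rightarrow> (int^'d) set" where
  "active \<Phi> \<nu> y = {q. \<Phi> (rel_node \<nu> y q) \<noteq> 0}"

lemma
  fixes S :: "'d::finite \<Rightarrow> 'a set"
  assumes "\<And>i. finite (S i)"
  shows finite_vec_box: "finite {v :: 'a^'d. \<forall>i. v $ i \<in> S i}"
    and card_vec_box: "card {v :: 'a^'d. \<forall>i. v $ i \<in> S i} = (\<Prod>i\<in>UNIV. card (S i))"
proof -
  have eq: "{v :: 'a^'d. \<forall>i. v $ i \<in> S i} = vec_lambda ` PiE UNIV S"
  proof safe
    fix v :: "'a^'d" assume "\<forall>i. v $ i \<in> S i"
    thus "v \<in> vec_lambda ` PiE UNIV S" by (intro image_eqI[of _ _ "vec_nth v"]) auto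
  qed auto
  have "inj_on (vec_lambda :: _ \<Rightarrow> 'a^'d) (PiE UNIV S)"
    by (auto intro!: inj_onI simp: vec_eq_iff)
  thus "card {v :: 'a^'d. \<forall>i. v $ i \<in> S i} = (\<Prod>i\<in>UNIV. card (S i))"
    unfolding eq by (simp add: card_image card_PiE)
  show "finite {v :: 'a^'d. \<forall>i. v $ i \<in> S i}"
    unfolding eq using assms by (intro finite_imageI finite_PiE) auto
qed

lemma active_in_box:
  fixes y :: "real^'d::finite"
  assumes supp: "\<And>z. \<Phi> z \<noteq> 0 \<Longrightarrow> norm z \<le> 1" and "\<nu> > 0" "q \<in> active \<Phi> \<nu> y"
  shows "q $ i \<in> {\<lfloor>y $ i\<rfloor> - (\<lceil>\<nu>\<rceil> + 1) .. \<lfloor>y $ i\<rfloor> + (\<lceil>\<nu>\<rceil> + 1)}"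
proof -
  have "norm (rel_node \<nu> y q) \<le> 1" using assms by (auto simp: active_def)
  hence "\<bar>rel_node \<nu> y q $ i\<bar> \<le> 1" using component_le_norm_cart order_trans by blast
  hence "\<bar>y $ i - of_int (q $ i)\<bar> \<le> \<nu>"
    using \<open>\<nu> > 0\<close> by (simp add: rel_node_def grid_pt_def field_simps abs_mult)
  thus ?thesis by (simp add: abs_le_iff) linarith
qed

lemma
  fixes y :: "real^'d::finite"
  assumes supp: "\<And>z. \<Phi> z \<noteq> 0 \<Longrightarrow> norm z \<le> 1" and "\<nu> > 0"
  shows finite_active: "finite (active \<Phi> \<nu> y)"
    and card_active_le: "real (card (active \<Phi> \<nu> y)) \<le> (2 * \<nu> + 5) ^ CARD('d)"
proof -
  let ?B = "{q :: int^'d. \<forall>i. q $ i \<in> {\<lfloor>y $ i\<rfloor> - (\<lceil>\<nu>\<rceil> + 1) .. \<lfloor>y $ i\<rfloor> + (\<lceil>\<nu>\<rceil> + 1)}}"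
  have fin: "finite ?B" by (rule finite_vec_box) simp
  have sub: "active \<Phi> \<nu> y \<subseteq> ?B" using active_in_box[OF assms] by blast
  show "finite (active \<Phi> \<nu> y)" using fin sub finite_subset by blast
  have "real (card (active \<Phi> \<nu> y)) \<le> real (card ?B)" using fin sub by (simp add: card_mono)
  also have "\<dots> = real (nat (2 * \<lceil>\<nu>\<rceil> + 3)) ^ CARD('d)"
    by (subst card_vec_box) (simp_all add: algebra_simps)
  also have "\<dots> \<le> (2 * \<nu> + 5) ^ CARD('d)"
    using \<open>\<nu> > 0\<close> by (intro power_mono) linarith+
  finally show "real (card (active \<Phi> \<nu> y)) \<le> (2 * \<nu> + 5) ^ CARD('d)" .
qed

text \<open>The cube of half side \<open>R\<close> around \<open>c\<close> lies in the ball and contains at least \<open>\<lfloor>R\<rfloor>\<close> integers per coordinate,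
  counted downwards from \<open>\<lfloor>c $ i\<rfloor>\<close>, and \<open>\<lfloor>R\<rfloor> \<ge> R / 2\<close>.\<close>

lemma lattice_points_in_ball:
  fixes c :: "real^'d::finite"
  assumes "R \<ge> 1"
  obtains B :: "(int^'d) set" where "finite B" "(R / 2) ^ CARD('d) \<le> real (card B)"
    "\<And>q. q \<in> B \<Longrightarrow> norm (c - grid_pt 1 q) < real CARD('d) * R"
proof -
  let ?B = "{q :: int^'d. \<forall>i. q $ i \<in> {\<lfloor>c $ i\<rfloor> - \<lfloor>R\<rfloor> + 1 .. \<lfloor>c $ i\<rfloor>}}"
  show ?thesis
  proof (rule that[of ?B])
    show "finite ?B" by (rule finite_vec_box) simp
    have "real (nat \<lfloor>R\<rfloor>) = of_int \<lfloor>R\<rfloor>" "1 \<le> \<lfloor>R\<rfloor>" using assms by simp_all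
    hence "R / 2 \<le> real (nat \<lfloor>R\<rfloor>)" by linarith
    hence "(R / 2) ^ CARD('d) \<le> real (nat \<lfloor>R\<rfloor>) ^ CARD('d)"
      using assms by (intro power_mono) simp_all
    also have "\<dots> = real (card ?B)" by (subst card_vec_box) simp_all
    finally show "(R / 2) ^ CARD('d) \<le> real (card ?B)" .
    fix q assume q: "q \<in> ?B"
    have "\<bar>(c - grid_pt 1 q) $ i\<bar> < R" for i
    proof -
      have "\<lfloor>c $ i\<rfloor> - \<lfloor>R\<rfloor> + 1 \<le> q $ i" "q $ i \<le> \<lfloor>c $ i\<rfloor>" using q by auto
      thus ?thesis by (simp add: grid_pt_def abs_less_iff) linarith
    qed
    hence "(\<Sum>i\<in>UNIV. \<bar>(c - grid_pt 1 q) $ i\<bar>) < (\<Sum>i\<in>(UNIV::'d set). R)"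
      by (intro sum_strict_mono) auto
    thus "norm (c - grid_pt 1 q) < real CARD('d) * R"
      using norm_le_l1_cart[of "c - grid_pt 1 q"] by simp
  qed
qed

section \<open>A uniform lower bound for kernel-weighted squares\<close>

text \<open>For a fixed coefficient vector \<open>v \<noteq> 0\<close>, the polynomial cannot vanish on the open set where \<open>\<Phi> > 0\<close>, so
  the product is positive somewhere, and by joint continuity it stays away from zero on a ball, for
  all coefficient vectors near \<open>v\<close>. Compactness of the unit sphere makes the two constants
  uniform, and homogeneity of degree two extends the estimate to all \<open>v\<close>. The centre \<open>z0\<close> has to
  depend on \<open>v\<close>, since the zero set of the polynomial moves.\<close>

lemma kernel_weighted_square_uniformly_positive:
  fixes \<Phi> :: "real^'d::finite \<Rightarrow> real" and p :: "'b::finite \<Rightarrow> real^'d \<Rightarrow> real"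
  assumes cont: "continuous_on UNIV \<Phi>" and nn: "\<And>x. 0 \<le> \<Phi> x" and nz: "\<Phi> u \<noteq> 0"
    and basis: "poly_basis r p"
  obtains \<kappa> \<epsilon> where "\<kappa> > 0" "\<epsilon> > 0"
    "\<And>v :: real^'b. \<exists>z0. \<forall>z\<in>ball z0 \<epsilon>. \<kappa> * (norm v)\<^sup>2 \<le> \<Phi> z * (\<Sum>j\<in>UNIV. v $ j * p j z)\<^sup>2"
proof -
  define G where "G = (\<lambda>w :: (real^'b) \<times> (real^'d). \<Phi> (snd w) * (\<Sum>j\<in>UNIV. fst w $ j * p j (snd w))\<^sup>2)"
  have contp: "continuous_on UNIV (p j)" for j
    using basis by (auto simp: poly_basis_def intro: continuous_on_polys)
  have G: "continuous_on UNIV G" unfolding G_def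
    by (intro continuous_intros continuous_on_compose2[OF contp] continuous_on_compose2[OF cont]) auto
  define good where "good U \<longleftrightarrow> (\<exists>\<kappa>>0. \<exists>\<epsilon>>0. \<forall>v\<in>U. \<exists>z0. \<forall>z\<in>ball z0 \<epsilon>. \<kappa> \<le> G (v, z))" for U
  have pos: "\<exists>z. G (v, z) > 0" if "norm v = 1" for v
  proof (rule ccontr)
    assume "\<not> ?thesis"
    moreover have "G (v, z) \<ge> 0" for z by (simp add: G_def nn)
    ultimately have G0: "G (v, z) = 0" for z by (meson antisym not_less)
    have "open {x. \<Phi> x \<noteq> 0}" using cont by (intro open_Collect_neq) auto
    then obtain e where e: "e > 0" "ball u e \<subseteq> {x. \<Phi> x \<noteq> 0}"
      using nz by (auto simp: open_contains_ball)
    have "(\<lambda>z. \<Sum>j\<in>UNIV. v $ j * p j z) \<in> polys r"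
      using basis by (intro polys_sum polys_cmult) (auto simp: poly_basis_def)
    moreover have "(\<Sum>j\<in>UNIV. v $ j * p j z) = 0" if "z \<in> ball u e" for z
      using G0[of z] e that by (auto simp: G_def)
    ultimately have "(\<Sum>j\<in>UNIV. v $ j * p j z) = 0" for z
      using polys_zero_on_ball e(1) by blast
    hence "\<forall>j. v $ j = 0" using basis unfolding poly_basis_def by blast
    hence "v = 0" by (simp add: vec_eq_iff)
    with that show False by simp
  qed
  have loc: "\<exists>U. open U \<and> v \<in> U \<and> good U" if v1: "norm v = 1" for v
  proof -
    obtain z where z: "G (v, z) > 0" using pos[OF v1] by blast
    have "open {w. G (v, z) / 2 < G w}" using G by (intro open_Collect_less) auto
    then obtain A B where AB: "open A" "open B" "(v, z) \<in> A \<times> B" "A \<times> B \<subseteq> {w. G (v, z) / 2 < G w}"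
      using z open_prod_elim[of "{w. G (v, z) / 2 < G w}" "(v, z)"] by auto
    then obtain e where e: "e > 0" "ball z e \<subseteq> B" by (auto simp: open_contains_ball)
    have "good A" unfolding good_def
      using z e AB by (intro exI[of _ "G (v, z) / 2"] conjI exI[of _ e]) (auto intro!: exI[of _ z] less_imp_le)
    thus ?thesis using AB by auto
  qed
  have cover: "sphere (0::real^'b) 1 \<subseteq> \<Union>{U. open U \<and> good U}"
  proof
    fix v :: "real^'b" assume "v \<in> sphere 0 1"
    with loc[of v] show "v \<in> \<Union>{U. open U \<and> good U}" by auto
  qed
  obtain D where D: "D \<subseteq> {U. open U \<and> good U}" "finite D" "sphere (0::real^'b) 1 \<subseteq> \<Union>D"
    by (rule compactE[OF compact_sphere cover]) auto
  have "finite E \<Longrightarrow> E \<subseteq> {U. open U \<and> good U} \<Longrightarrow> good (\<Union>E)" for E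
  proof (induction E rule: finite_induct)
    case empty
    show ?case by (auto simp: good_def intro!: exI[of _ 1])
  next
    case (insert U E)
    then obtain k1 e1 k2 e2 where
      g1: "k1 > 0" "e1 > 0" "\<forall>v\<in>U. \<exists>z0. \<forall>z\<in>ball z0 e1. k1 \<le> G (v, z)" and
      g2: "k2 > 0" "e2 > 0" "\<forall>v\<in>\<Union>E. \<exists>z0. \<forall>z\<in>ball z0 e2. k2 \<le> G (v, z)"
      unfolding good_def by auto
    have "\<forall>v\<in>\<Union>(insert U E). \<exists>z0. \<forall>z\<in>ball z0 (min e1 e2). min k1 k2 \<le> G (v, z)"
    proof
      fix v assume "v \<in> \<Union>(insert U E)"
      then consider "v \<in> U" | "v \<in> \<Union>E" by auto
      thus "\<exists>z0. \<forall>z\<in>ball z0 (min e1 e2). min k1 k2 \<le> G (v, z)"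
      proof cases
        case 1
        then obtain z0 where "\<forall>z\<in>ball z0 e1. k1 \<le> G (v, z)" using g1 by blast
        thus ?thesis by (intro exI[of _ z0]) (auto simp: min_le_iff_disj)
      next
        case 2
        then obtain z0 where "\<forall>z\<in>ball z0 e2. k2 \<le> G (v, z)" using g2 by blast
        thus ?thesis by (intro exI[of _ z0]) (auto simp: min_le_iff_disj)
      qed
    qed
    thus ?case unfolding good_def using g1 g2
      by (intro exI[of _ "min k1 k2"] conjI exI[of _ "min e1 e2"]) auto
  qed
  with D obtain \<kappa> \<epsilon> where \<kappa>: "\<kappa> > 0" and \<epsilon>: "\<epsilon> > 0"
    and bnd: "\<forall>v\<in>\<Union>D. \<exists>z0. \<forall>z\<in>ball z0 \<epsilon>. \<kappa> \<le> G (v, z)"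
    unfolding good_def by meson
  show ?thesis
  proof (rule that[OF \<kappa> \<epsilon>])
    fix v :: "real^'b"
    show "\<exists>z0. \<forall>z\<in>ball z0 \<epsilon>. \<kappa> * (norm v)\<^sup>2 \<le> \<Phi> z * (\<Sum>j\<in>UNIV. v $ j * p j z)\<^sup>2"
    proof (cases "v = 0")
      case False
      define v' where "v' = v /\<^sub>R norm v"
      have "v' \<in> sphere 0 1" using False by (simp add: v'_def)
      then obtain z0 where z0: "\<forall>z\<in>ball z0 \<epsilon>. \<kappa> \<le> G (v', z)" using bnd D(3) by blast
      have "\<kappa> * (norm v)\<^sup>2 \<le> \<Phi> z * (\<Sum>j\<in>UNIV. v $ j * p j z)\<^sup>2" if "z \<in> ball z0 \<epsilon>" for z
      proof -
        have "(\<Sum>j\<in>UNIV. v' $ j * p j z) * norm v = (\<Sum>j\<in>UNIV. v $ j * p j z)"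
          using False by (simp add: v'_def sum_divide_distrib[symmetric] divide_inverse_commute[symmetric])
        hence "G (v', z) * (norm v)\<^sup>2 = \<Phi> z * (\<Sum>j\<in>UNIV. v $ j * p j z)\<^sup>2"
          by (simp add: G_def power_mult_distrib[symmetric])
        thus ?thesis using z0 that by (metis mult_right_mono zero_le_power2)
      qed
      thus ?thesis by blast
    qed (simp add: nn)
  qed
qed

section \<open>Boundedness of the Lebesgue constant\<close>

text \<open>The weights \<open>\<Phi> * s\<close>, with \<open>s\<close> a polynomial, reproduce \<open>g 0\<close> from the values of \<open>g\<close> at the scaled nodes.
  Moving least-squares weights are of this kind; in this formulation the basis has disappeared.\<close>

definition reproducing :: "nat \<Rightarrow> (real^'d::finite \<Rightarrow> real) \<Rightarrow> real \<Rightarrow> real^'d \<Rightarrow> (real^'d \<Rightarrow> real) \<Rightarrow> bool" where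
  "reproducing r \<Phi> \<nu> y s \<longleftrightarrow> s \<in> polys r \<and> (\<forall>g\<in>polys r.
     (\<Sum>q\<in>active \<Phi> \<nu> y. \<Phi> (rel_node \<nu> y q) * s (rel_node \<nu> y q) * g (rel_node \<nu> y q)) = g 0)"

text \<open>Subtracting the integer part of \<open>y\<close> moves the evaluation point to the unit cube and the active grid
  points into a box that depends only on \<open>N\<close>. On this box the bound by sign patterns applies, to the
  polynomial \<open>s\<close> rewritten in the grid variable.\<close>

lemma reproducing_bounded_small:
  fixes \<Phi> :: "real^'d::finite \<Rightarrow> real"
  assumes nn: "\<And>x. 0 \<le> \<Phi> x" and supp: "\<And>z. \<Phi> z \<noteq> 0 \<Longrightarrow> norm z \<le> 1"
  obtains L where "\<And>\<nu> y s. 0 < \<nu> \<Longrightarrow> \<nu> \<le> N \<Longrightarrow> reproducing r \<Phi> \<nu> y s \<Longrightarrow>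
    (\<Sum>q\<in>active \<Phi> \<nu> y. \<bar>\<Phi> (rel_node \<nu> y q) * s (rel_node \<nu> y q)\<bar>) \<le> L"
proof -
  let ?F = "grid_pt 1 ` {q :: int^'d. \<forall>i. q $ i \<in> {- (\<lceil>N\<rceil> + 1) .. \<lceil>N\<rceil> + 1}}"
  have finF: "finite ?F" by (intro finite_imageI finite_vec_box) simp
  have bdd: "bounded (g ` cbox 0 1)" if "g \<in> polys r" for g :: "real^'d \<Rightarrow> real"
    using that by (intro compact_imp_bounded compact_continuous_image continuous_on_polys) auto
  obtain L where L: "\<And>A c s t. A \<subseteq> ?F \<Longrightarrow> s \<in> polys r \<Longrightarrow> t \<in> cbox 0 1 \<Longrightarrow> (\<And>z. z \<in> A \<Longrightarrow> 0 \<le> c z) \<Longrightarrow>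
     (\<And>g. g \<in> polys r \<Longrightarrow> (\<Sum>z\<in>A. c z * s z * g z) = g t) \<Longrightarrow> (\<Sum>z\<in>A. \<bar>c z * s z\<bar>) \<le> L"
    using reproducing_weights_bounded_by_sign_patterns[OF finF bdd] by blast
  show ?thesis
  proof (rule that[of L])
    fix \<nu> y s
    assume \<nu>: "0 < \<nu>" "\<nu> \<le> N" and rep: "reproducing r \<Phi> \<nu> y s"
    define n :: "int^'d" where "n = (\<chi> i. \<lfloor>y $ i\<rfloor>)"
    define t where "t = y - grid_pt 1 n"
    define \<iota> where "\<iota> q = grid_pt 1 (q - n)" for q
    define s' where "s' z = s ((t - z) /\<^sub>R \<nu>)" for z
    define c where "c z = \<Phi> ((t - z) /\<^sub>R \<nu>)" for z
    have node: "rel_node \<nu> y q = (t - \<iota> q) /\<^sub>R \<nu>" for q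
      by (simp add: rel_node_def t_def \<iota>_def grid_pt_def vec_eq_iff)
    have inj: "inj_on \<iota> S" for S
      by (auto intro!: inj_onI simp: \<iota>_def grid_pt_def vec_eq_iff)
    have t: "t \<in> cbox 0 1"
      unfolding mem_box_cart by (auto simp: t_def n_def grid_pt_def) linarith+
    have "s' = (\<lambda>z. s (t /\<^sub>R \<nu> + (- inverse \<nu>) *\<^sub>R z))"
      by (auto simp: s'_def fun_eq_iff scaleR_diff_right)
    moreover have "s \<in> polys r" using rep by (simp add: reproducing_def)
    ultimately have s': "s' \<in> polys r" using polys_affine by metis
    have sub: "\<iota> ` active \<Phi> \<nu> y \<subseteq> ?F"
    proof safe
      fix q assume "q \<in> active \<Phi> \<nu> y"
      note box = active_in_box[OF supp \<nu>(1) this]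
      have "\<lceil>\<nu>\<rceil> \<le> \<lceil>N\<rceil>" using \<nu>(2) by (rule ceiling_mono)
      hence "(q - n) $ i \<in> {- (\<lceil>N\<rceil> + 1) .. \<lceil>N\<rceil> + 1}" for i
        using box[of i] by (simp add: n_def)
      thus "\<iota> q \<in> ?F" by (auto simp: \<iota>_def)
    qed
    have "(\<Sum>z\<in>\<iota> ` active \<Phi> \<nu> y. \<bar>c z * s' z\<bar>) \<le> L"
    proof (rule L[OF sub s' t])
      fix z show "0 \<le> c z" by (simp add: c_def nn)
    next
      fix g :: "real^'d \<Rightarrow> real" assume g: "g \<in> polys r"
      have "(\<lambda>\<zeta>. g (t + (- \<nu>) *\<^sub>R \<zeta>)) \<in> polys r" using g by (rule polys_affine)
      hence "(\<Sum>q\<in>active \<Phi> \<nu> y. \<Phi> (rel_node \<nu> y q) * s (rel_node \<nu> y q) *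
               g (t + (- \<nu>) *\<^sub>R rel_node \<nu> y q)) = g t"
        using rep unfolding reproducing_def by fastforce
      moreover have "t + (- \<nu>) *\<^sub>R rel_node \<nu> y q = \<iota> q" for q
        using \<nu>(1) by (simp add: node)
      ultimately show "(\<Sum>z\<in>\<iota> ` active \<Phi> \<nu> y. c z * s' z * g z) = g t"
        by (simp add: sum.reindex[OF inj] node c_def s'_def)
    qed
    thus "(\<Sum>q\<in>active \<Phi> \<nu> y. \<bar>\<Phi> (rel_node \<nu> y q) * s (rel_node \<nu> y q)\<bar>) \<le> L"
      by (simp add: sum.reindex[OF inj] node c_def s'_def)
  qed
qed

text \<open>Let \<open>v\<close> be the coefficient vector of \<open>s\<close> and \<open>d\<close> the dimension. Reproduction of \<open>s\<close> itself gives
  \<open>\<Sum>q. \<Phi> * s\<^sup>2 = s 0 \<le> B * norm v\<close>, while the left-hand side is at least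
  \<open>(R / 2) ^ d * \<kappa> * (norm v)\<^sup>2\<close> with \<open>R = \<epsilon> * \<nu> / d\<close>, by counting the grid points in the ball on which the
  integrand is large. Hence \<open>norm v\<close> is of order \<open>\<nu> ^ (- d)\<close>, and the sum of the absolute weights, which
  has at most \<open>(7 * \<nu>) ^ d\<close> terms, is bounded. The threshold \<open>d / \<epsilon>\<close> on \<open>\<nu>\<close> is the condition \<open>R \<ge> 1\<close>
  under which the count is valid.\<close>

lemma reproducing_bounded_large:
  fixes \<Phi> :: "real^'d::finite \<Rightarrow> real" and p :: "'b::finite \<Rightarrow> real^'d \<Rightarrow> real"
  assumes cont: "continuous_on UNIV \<Phi>" and nn: "\<And>x. 0 \<le> \<Phi> x" and nz: "\<Phi> u \<noteq> 0"
    and supp: "\<And>z. \<Phi> z \<noteq> 0 \<Longrightarrow> norm z \<le> 1" and basis: "poly_basis r p"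
  obtains N L where "\<And>\<nu> y s. 1 < \<nu> \<Longrightarrow> N \<le> \<nu> \<Longrightarrow> reproducing r \<Phi> \<nu> y s \<Longrightarrow>
    (\<Sum>q\<in>active \<Phi> \<nu> y. \<bar>\<Phi> (rel_node \<nu> y q) * s (rel_node \<nu> y q)\<bar>) \<le> L"
proof -
  define D where "D = real CARD('d)"
  have D: "D > 0" by (simp add: D_def)
  obtain \<kappa> \<epsilon> where \<kappa>: "\<kappa> > 0" and \<epsilon>: "\<epsilon> > 0" and low:
    "\<And>v :: real^'b. \<exists>z0. \<forall>z\<in>ball z0 \<epsilon>. \<kappa> * (norm v)\<^sup>2 \<le> \<Phi> z * (\<Sum>j\<in>UNIV. v $ j * p j z)\<^sup>2"
    using kernel_weighted_square_uniformly_positive[OF cont nn nz basis] by blast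
  have contp: "continuous_on S (p j)" for j S
    using basis by (auto simp: poly_basis_def intro: continuous_on_polys)
  have bd: "\<exists>B>0. \<forall>z\<in>cball 0 1. \<bar>f z\<bar> \<le> B" if "continuous_on UNIV f" for f :: "real^'d \<Rightarrow> real"
  proof -
    have "bounded (f ` cball 0 1)"
      using that by (intro compact_imp_bounded compact_continuous_image continuous_on_subset[OF that]) auto
    thus ?thesis unfolding bounded_pos by auto
  qed
  have contsum: "continuous_on UNIV (\<lambda>z. \<Sum>j\<in>UNIV. \<bar>p j z\<bar>)"
    by (intro continuous_intros contp)
  obtain B where B: "B > 0" "\<And>z. z \<in> cball 0 1 \<Longrightarrow> \<bar>\<Sum>j\<in>UNIV. \<bar>p j z\<bar>\<bar> \<le> B"
    using bd[OF contsum] by blast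
  obtain P where P: "P > 0" "\<And>z. z \<in> cball 0 1 \<Longrightarrow> \<bar>\<Phi> z\<bar> \<le> P" using bd[OF cont] by blast
  define L where "L = P * B * (B / \<kappa>) * (14 * D / \<epsilon>) ^ CARD('d)"
  show ?thesis
  proof (rule that[of "D / \<epsilon>" L])
    fix \<nu> y s
    assume \<nu>: "1 < \<nu>" "D / \<epsilon> \<le> \<nu>" and rep: "reproducing r \<Phi> \<nu> y s"
    let ?A = "active \<Phi> \<nu> y" and ?\<xi> = "rel_node \<nu> y"
    have finA: "finite ?A" using finite_active[OF supp] \<nu> by simp
    have \<xi>: "norm (?\<xi> q) \<le> 1" if "q \<in> ?A" for q using that supp by (auto simp: active_def)
    have "s \<in> polys r" using rep by (simp add: reproducing_def)
    then obtain c where c: "s = (\<lambda>x. \<Sum>j\<in>UNIV. c j * p j x)"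
      using poly_basis_expansion[OF basis] by blast
    define v :: "real^'b" where "v = (\<chi> j. c j)"
    have s: "s z = (\<Sum>j\<in>UNIV. v $ j * p j z)" for z by (simp add: c v_def)
    have s_le: "\<bar>s z\<bar> \<le> B * norm v" if "norm z \<le> 1" for z
    proof -
      have "\<bar>s z\<bar> \<le> (\<Sum>j\<in>UNIV. \<bar>v $ j * p j z\<bar>)" unfolding s by (rule sum_abs)
      also have "\<dots> \<le> (\<Sum>j\<in>UNIV. \<bar>p j z\<bar> * norm v)"
        by (intro sum_mono) (simp add: abs_mult mult.commute mult_right_mono component_le_norm_cart)
      also have "\<dots> = (\<Sum>j\<in>UNIV. \<bar>p j z\<bar>) * norm v" by (simp add: sum_distrib_right)
      also have "\<dots> \<le> B * norm v" using B(2)[of z] that by (intro mult_right_mono) auto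
      finally show ?thesis .
    qed
    define R where "R = \<epsilon> * \<nu> / D"
    have R: "R \<ge> 1" using \<nu>(2) \<epsilon> D by (simp add: R_def field_simps)
    obtain z0 where z0: "\<And>z. z \<in> ball z0 \<epsilon> \<Longrightarrow> \<kappa> * (norm v)\<^sup>2 \<le> \<Phi> z * (s z)\<^sup>2"
      using low[of v] unfolding s by blast
    obtain Q :: "(int^'d) set" where Q: "finite Q" "(R / 2) ^ CARD('d) \<le> real (card Q)"
      "\<And>q. q \<in> Q \<Longrightarrow> norm (y - \<nu> *\<^sub>R z0 - grid_pt 1 q) < D * R"
      using lattice_points_in_ball[OF R, of "y - \<nu> *\<^sub>R z0"] unfolding D_def by blast
    have in_ball: "?\<xi> q \<in> ball z0 \<epsilon>" if "q \<in> Q" for q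
    proof -
      have "?\<xi> q - z0 = (y - \<nu> *\<^sub>R z0 - grid_pt 1 q) /\<^sub>R \<nu>"
        using \<nu>(1) by (simp add: rel_node_def algebra_simps)
      hence "norm (?\<xi> q - z0) = norm (y - \<nu> *\<^sub>R z0 - grid_pt 1 q) / \<nu>"
        using \<nu>(1) by (simp add: divide_inverse)
      also have "\<dots> < \<epsilon>" using Q(3)[OF that] \<nu>(1) D by (simp add: R_def field_simps)
      finally show ?thesis by (simp add: dist_norm norm_minus_commute)
    qed
    have "norm v \<le> B / (\<kappa> * (R / 2) ^ CARD('d))"
    proof (cases "v = 0")
      case False
      have "Q \<subseteq> ?A"
      proof
        fix q assume "q \<in> Q"
        from z0[OF in_ball[OF this]] have "\<Phi> (?\<xi> q) \<noteq> 0"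
          using \<kappa> False by (auto simp: zero_less_mult_iff mult_le_0_iff)
        thus "q \<in> ?A" by (simp add: active_def)
      qed
      have "(R / 2) ^ CARD('d) * (\<kappa> * (norm v)\<^sup>2) \<le> real (card Q) * (\<kappa> * (norm v)\<^sup>2)"
        using Q(2) \<kappa> by (intro mult_right_mono) auto
      also have "\<dots> = (\<Sum>q\<in>Q. \<kappa> * (norm v)\<^sup>2)" by simp
      also have "\<dots> \<le> (\<Sum>q\<in>Q. \<Phi> (?\<xi> q) * (s (?\<xi> q))\<^sup>2)"
        using z0 in_ball by (intro sum_mono) blast
      also have "\<dots> \<le> (\<Sum>q\<in>?A. \<Phi> (?\<xi> q) * (s (?\<xi> q))\<^sup>2)"
        using finA \<open>Q \<subseteq> ?A\<close> nn by (intro sum_mono2) auto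
      also have "\<dots> = s 0"
        using rep unfolding reproducing_def by (simp add: power2_eq_square mult.assoc)
      also have "\<dots> \<le> B * norm v" using s_le[of 0] by simp
      finally have "((R / 2) ^ CARD('d) * \<kappa> * norm v) * norm v \<le> B * norm v"
        by (simp add: power2_eq_square mult.assoc)
      hence "(R / 2) ^ CARD('d) * \<kappa> * norm v \<le> B" using False by simp
      thus ?thesis using \<kappa> R by (simp add: field_simps)
    qed (use B \<kappa> R in simp)
    have "(\<Sum>q\<in>?A. \<bar>\<Phi> (?\<xi> q) * s (?\<xi> q)\<bar>) \<le> (\<Sum>q\<in>?A. P * (B * norm v))"
      unfolding abs_mult using P \<xi> s_le by (intro sum_mono mult_mono) auto
    also have "\<dots> = real (card ?A) * (P * (B * norm v))" by simp
    also have "\<dots> \<le> (2 * \<nu> + 5) ^ CARD('d) * (P * (B * norm v))"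
      using card_active_le[OF supp, of \<Phi> \<nu> y] \<nu> P(1) B(1) by (intro mult_right_mono) auto
    also have "\<dots> \<le> (7 * \<nu>) ^ CARD('d) * (P * (B * (B / (\<kappa> * (R / 2) ^ CARD('d)))))"
      using \<nu> P(1) B(1) \<open>norm v \<le> _\<close> by (intro mult_mono power_mono) auto
    also have "\<dots> = P * B * (B / \<kappa>) * ((7 * \<nu>) / (R / 2)) ^ CARD('d)"
      by (simp only: power_divide) simp
    also have "(7 * \<nu>) / (R / 2) = 14 * D / \<epsilon>"
      using \<nu>(1) \<epsilon> D by (simp add: R_def field_simps)
    finally show "(\<Sum>q\<in>?A. \<bar>\<Phi> (?\<xi> q) * s (?\<xi> q)\<bar>) \<le> L" by (simp add: L_def)
  qed
qed

lemma lebesgue_constant_bounded: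
  fixes \<Phi> :: "real^'d::finite \<Rightarrow> real" and p :: "'b::finite \<Rightarrow> real^'d \<Rightarrow> real"
  assumes cont: "continuous_on UNIV \<Phi>" and nn: "\<And>x. 0 \<le> \<Phi> x" and nz: "\<Phi> u \<noteq> 0"
    and supp: "\<And>z. \<Phi> z \<noteq> 0 \<Longrightarrow> norm z \<le> 1" and basis: "poly_basis r p"
  obtains L where "L > 0" "\<And>\<nu> y s. 1 < \<nu> \<Longrightarrow> reproducing r \<Phi> \<nu> y s \<Longrightarrow>
    (\<Sum>q\<in>active \<Phi> \<nu> y. \<bar>\<Phi> (rel_node \<nu> y q) * s (rel_node \<nu> y q)\<bar>) \<le> L"
proof -
  show ?thesis
  proof (rule reproducing_bounded_large[OF cont nn nz supp basis])
    fix N L1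
    assume L1: "\<And>\<nu> y s. 1 < \<nu> \<Longrightarrow> N \<le> \<nu> \<Longrightarrow> reproducing r \<Phi> \<nu> y s \<Longrightarrow>
      (\<Sum>q\<in>active \<Phi> \<nu> y. \<bar>\<Phi> (rel_node \<nu> y q) * s (rel_node \<nu> y q)\<bar>) \<le> L1"
    show ?thesis
    proof (rule reproducing_bounded_small[OF nn supp])
      fix L2
      assume L2: "\<And>\<nu> y s. 0 < \<nu> \<Longrightarrow> \<nu> \<le> N \<Longrightarrow> reproducing r \<Phi> \<nu> y s \<Longrightarrow>
        (\<Sum>q\<in>active \<Phi> \<nu> y. \<bar>\<Phi> (rel_node \<nu> y q) * s (rel_node \<nu> y q)\<bar>) \<le> L2"
      show ?thesis
      proof (rule that[of "max 1 (max L1 L2)"])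
        fix \<nu> y s assume "1 < \<nu>" "reproducing r \<Phi> \<nu> y s"
        thus "(\<Sum>q\<in>active \<Phi> \<nu> y. \<bar>\<Phi> (rel_node \<nu> y q) * s (rel_node \<nu> y q)\<bar>) \<le> max 1 (max L1 L2)"
          using L1[of \<nu> y s] L2[of \<nu> y s] by (cases "N \<le> \<nu>") (auto simp: le_max_iff_disj)
      qed simp
    qed
  qed
qed

section \<open>Partial derivatives and Taylor's formula\<close>

lemma linear_eq_sum_axis:
  fixes L :: "real^'d::finite \<Rightarrow> real"
  assumes "linear L" shows "L u = (\<Sum>i\<in>UNIV. L (axis i 1) * u $ i)"
proof -
  have "L u = L (\<Sum>i\<in>UNIV. u $ i *\<^sub>R axis i 1)"
    using basis_expansion[of u] by (simp add: scalar_mult_eq_scaleR)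
  also have "\<dots> = (\<Sum>i\<in>UNIV. u $ i *\<^sub>R L (axis i 1))"
    using assms by (simp add: linear_sum linear_cmul)
  finally show ?thesis by (simp add: mult.commute)
qed

lemma has_derivative_partial_deriv:
  fixes F :: "real^'d::finite \<Rightarrow> real"
  assumes "F differentiable_on UNIV"
  shows "(F has_derivative (\<lambda>u. \<Sum>i\<in>UNIV. partial_deriv i F z * u $ i)) (at z)"
proof -
  obtain L where L: "(F has_derivative L) (at z)"
    using assms by (auto simp: differentiable_on_def differentiable_def)
  have lin: "linear L" using L by (rule has_derivative_linear)
  have "partial_deriv i F z = L (axis i 1)" for i
  proof -
    have "((\<lambda>t. z + t *\<^sub>R axis i 1) has_derivative (\<lambda>t. t *\<^sub>R axis i 1)) (at (0::real))"
      by (auto intro!: derivative_eq_intros)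
    moreover have "(F has_derivative L) (at (z + 0 *\<^sub>R axis i 1))" using L by simp
    ultimately have "((\<lambda>t. F (z + t *\<^sub>R axis i 1)) has_derivative (\<lambda>t. L (t *\<^sub>R axis i 1))) (at 0)"
      by (rule has_derivative_compose)
    moreover have "(\<lambda>t. L (t *\<^sub>R axis i 1)) = (*) (L (axis i 1))"
      by (intro ext) (simp add: linear_cmul[OF lin] mult.commute)
    ultimately have "((\<lambda>t. F (z + t *\<^sub>R axis i 1)) has_real_derivative L (axis i 1)) (at 0)"
      unfolding has_field_derivative_def by (simp only:)
    thus ?thesis unfolding partial_deriv_def by (rule DERIV_imp_deriv)
  qed
  hence "(\<lambda>u. \<Sum>i\<in>UNIV. partial_deriv i F z * u $ i) = L"
    by (simp only: linear_eq_sum_axis[OF lin, symmetric])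
  thus ?thesis using L by simp
qed

lemma has_derivative_along_line:
  fixes F :: "real^'d::finite \<Rightarrow> real"
  assumes "F differentiable_on UNIV"
  shows "((\<lambda>t. F (x + t *\<^sub>R u)) has_real_derivative
           (\<Sum>i\<in>UNIV. partial_deriv i F (x + t *\<^sub>R u) * u $ i)) (at t)"
proof -
  let ?L = "\<lambda>w. \<Sum>i\<in>UNIV. partial_deriv i F (x + t *\<^sub>R u) * w $ i"
  have "((\<lambda>t. x + t *\<^sub>R u) has_derivative (\<lambda>t. t *\<^sub>R u)) (at t)"
    by (auto intro!: derivative_eq_intros)
  hence "((\<lambda>t. F (x + t *\<^sub>R u)) has_derivative (\<lambda>t. ?L (t *\<^sub>R u))) (at t)"
    by (rule has_derivative_compose) (rule has_derivative_partial_deriv[OF assms])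
  moreover have "?L (t *\<^sub>R u) = ?L u * t" for t
    by (simp add: sum_distrib_left mult_ac)
  ultimately show ?thesis by (simp add: has_field_derivative_def)
qed

lemma C_k_pred: "C_k (Suc n) f \<Longrightarrow> C_k n f"
  by (induction n arbitrary: f) (auto intro: differentiable_imp_continuous_on)

lemma C_k_mono: "C_k n f \<Longrightarrow> m \<le> n \<Longrightarrow> C_k m f"
proof (induction n)
  case (Suc n)
  thus ?case using C_k_pred[of n f] by (cases "m = Suc n") (simp_all del: C_k.simps)
qed simp

lemma C_k_foldr_partial_deriv:
  "C_k (length ks + n) f \<Longrightarrow> C_k n (foldr partial_deriv ks f)"
proof (induction ks arbitrary: n)
  case (Cons i ks)
  have "C_k (Suc n) (foldr partial_deriv ks f)" using Cons.prems by (intro Cons.IH) simp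
  thus ?case by simp
qed simp

text \<open>The mean value theorem is applied first in direction \<open>i\<close> to the increment of \<open>f\<close> in direction \<open>j\<close>,
  and then in direction \<open>j\<close> to the partial derivative. The left-hand side is symmetric in \<open>i\<close> and \<open>j\<close>,
  which is what makes mixed partial derivatives agree.\<close>

lemma double_difference_eq_mixed_partial:
  fixes f :: "real^'d::finite \<Rightarrow> real"
  assumes f: "C_k 2 f" and "h > 0"
  obtains \<sigma> \<tau> where "0 < \<sigma>" "\<sigma> < h" "0 < \<tau>" "\<tau> < h"
    "f (x + h *\<^sub>R axis i 1 + h *\<^sub>R axis j 1) - f (x + h *\<^sub>R axis i 1) - f (x + h *\<^sub>R axis j 1) + f x
      = h\<^sup>2 * partial_deriv j (partial_deriv i f) (x + \<sigma> *\<^sub>R axis i 1 + \<tau> *\<^sub>R axis j 1)"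
proof -
  let ?a = "axis i 1 :: real^'d" and ?b = "axis j 1 :: real^'d"
  have d1: "f differentiable_on UNIV" and d2: "partial_deriv i f differentiable_on UNIV"
    using f by (auto simp: numeral_2_eq_2)
  have ax: "(\<Sum>k\<in>UNIV. c k * (axis l 1 :: real^'d) $ k) = c l" for c :: "'d \<Rightarrow> real" and l
    by (simp add: axis_def if_distrib[of "(*) _"] cong: if_cong)
  define g where "g s = f ((x + h *\<^sub>R ?b) + s *\<^sub>R ?a) - f (x + s *\<^sub>R ?a)" for s
  have "(g has_real_derivative
      partial_deriv i f ((x + h *\<^sub>R ?b) + s *\<^sub>R ?a) - partial_deriv i f (x + s *\<^sub>R ?a)) (at s)" for s
    unfolding g_def
    using DERIV_diff[OF has_derivative_along_line[OF d1, of "x + h *\<^sub>R ?b" ?a s]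
        has_derivative_along_line[OF d1, of x ?a s]] by (simp add: ax)
  from MVT2[OF \<open>h > 0\<close> this] obtain \<sigma> where \<sigma>: "0 < \<sigma>" "\<sigma> < h"
    "g h - g 0 = h * (partial_deriv i f ((x + h *\<^sub>R ?b) + \<sigma> *\<^sub>R ?a) - partial_deriv i f (x + \<sigma> *\<^sub>R ?a))"
    by auto
  have "((\<lambda>t. partial_deriv i f ((x + \<sigma> *\<^sub>R ?a) + t *\<^sub>R ?b)) has_real_derivative
      partial_deriv j (partial_deriv i f) ((x + \<sigma> *\<^sub>R ?a) + t *\<^sub>R ?b)) (at t)" for t
    using has_derivative_along_line[OF d2, of "x + \<sigma> *\<^sub>R ?a" ?b t] by (simp add: ax)
  from MVT2[OF \<open>h > 0\<close> this] obtain \<tau> where \<tau>: "0 < \<tau>" "\<tau> < h"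
    "partial_deriv i f ((x + \<sigma> *\<^sub>R ?a) + h *\<^sub>R ?b) - partial_deriv i f (x + \<sigma> *\<^sub>R ?a)
       = h * partial_deriv j (partial_deriv i f) ((x + \<sigma> *\<^sub>R ?a) + \<tau> *\<^sub>R ?b)"
    by auto
  show ?thesis
  proof (rule that[OF \<sigma>(1,2) \<tau>(1,2)])
    have "f (x + h *\<^sub>R ?a + h *\<^sub>R ?b) - f (x + h *\<^sub>R ?a) - f (x + h *\<^sub>R ?b) + f x = g h - g 0"
      by (simp add: g_def add_ac)
    also have "\<dots> = h * (partial_deriv i f ((x + \<sigma> *\<^sub>R ?a) + h *\<^sub>R ?b) - partial_deriv i f (x + \<sigma> *\<^sub>R ?a))"
      by (simp add: \<sigma>(3) add_ac)
    finally show "f (x + h *\<^sub>R ?a + h *\<^sub>R ?b) - f (x + h *\<^sub>R ?a) - f (x + h *\<^sub>R ?b) + f x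
        = h\<^sup>2 * partial_deriv j (partial_deriv i f) (x + \<sigma> *\<^sub>R ?a + \<tau> *\<^sub>R ?b)"
      by (simp only: \<tau>(3)) (simp add: power2_eq_square)
  qed
qed

lemma partial_deriv_commute:
  fixes f :: "real^'d::finite \<Rightarrow> real"
  assumes f: "C_k 2 f"
  shows "partial_deriv i (partial_deriv j f) = partial_deriv j (partial_deriv i f)"
proof
  fix x
  let ?a = "axis i 1 :: real^'d" and ?b = "axis j 1 :: real^'d"
  let ?P = "partial_deriv j (partial_deriv i f)" and ?Q = "partial_deriv i (partial_deriv j f)"
  have "continuous_on UNIV ?P" "continuous_on UNIV ?Q" using f by (auto simp: numeral_2_eq_2)
  hence cont: "isCont ?P x" "isCont ?Q x" by (auto simp: continuous_on_eq_continuous_at)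
  have "\<bar>?P x - ?Q x\<bar> < e" if "e > 0" for e
  proof -
    obtain d1 where d1: "d1 > 0" "\<And>y. dist y x < d1 \<Longrightarrow> dist (?P y) (?P x) < e / 2"
      using cont(1) \<open>e > 0\<close> unfolding continuous_at_eps_delta by (meson half_gt_zero)
    obtain d2 where d2: "d2 > 0" "\<And>y. dist y x < d2 \<Longrightarrow> dist (?Q y) (?Q x) < e / 2"
      using cont(2) \<open>e > 0\<close> unfolding continuous_at_eps_delta by (meson half_gt_zero)
    define h where "h = min d1 d2 / 2"
    have h: "h > 0" "2 * h \<le> d1" "2 * h \<le> d2" using d1 d2 by (auto simp: h_def)
    have near: "dist (x + s *\<^sub>R axis k 1 + t *\<^sub>R axis l 1) x < 2 * h"
      if "0 < s" "s < h" "0 < t" "t < h" for s t and k l :: 'd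
    proof -
      have "norm (s *\<^sub>R axis k 1 + t *\<^sub>R axis l 1 :: real^'d) \<le> s + t"
        using that norm_triangle_ineq[of "s *\<^sub>R axis k 1 :: real^'d" "t *\<^sub>R axis l 1"] by simp
      thus ?thesis using that by (simp add: dist_norm add.assoc)
    qed
    obtain s t where st: "0 < s" "s < h" "0 < t" "t < h"
      "f (x + h *\<^sub>R ?a + h *\<^sub>R ?b) - f (x + h *\<^sub>R ?a) - f (x + h *\<^sub>R ?b) + f x
         = h\<^sup>2 * ?P (x + s *\<^sub>R ?a + t *\<^sub>R ?b)"
      using double_difference_eq_mixed_partial[OF f h(1), of x i j] by blast
    obtain s' t' where st': "0 < s'" "s' < h" "0 < t'" "t' < h"
      "f (x + h *\<^sub>R ?b + h *\<^sub>R ?a) - f (x + h *\<^sub>R ?b) - f (x + h *\<^sub>R ?a) + f x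
         = h\<^sup>2 * ?Q (x + s' *\<^sub>R ?b + t' *\<^sub>R ?a)"
      using double_difference_eq_mixed_partial[OF f h(1), of x j i] by blast
    have "h\<^sup>2 * ?P (x + s *\<^sub>R ?a + t *\<^sub>R ?b) = h\<^sup>2 * ?Q (x + s' *\<^sub>R ?b + t' *\<^sub>R ?a)"
      unfolding st(5)[symmetric] st'(5)[symmetric] by (simp add: add_ac)
    hence eq: "?P (x + s *\<^sub>R ?a + t *\<^sub>R ?b) = ?Q (x + s' *\<^sub>R ?b + t' *\<^sub>R ?a)"
      using h(1) by simp
    have "dist (?P (x + s *\<^sub>R ?a + t *\<^sub>R ?b)) (?P x) < e / 2"
      using near[OF st(1-4), of i j] h(2) by (intro d1(2)) linarith
    moreover have "dist (?Q (x + s' *\<^sub>R ?b + t' *\<^sub>R ?a)) (?Q x) < e / 2"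
      using near[OF st'(1-4), of j i] h(3) by (intro d2(2)) linarith
    ultimately show ?thesis using eq unfolding dist_real_def by linarith
  qed
  hence "\<bar>?P x - ?Q x\<bar> \<le> 0" by (meson less_irrefl not_le)
  thus "?Q x = ?P x" by simp
qed

lemma foldr_partial_deriv_move_front:
  assumes "C_k (length as + length bs + 1) f"
  shows "foldr partial_deriv (as @ i # bs) f = foldr partial_deriv (i # as @ bs) f"
  using assms
proof (induction as)
  case (Cons a as)
  have "C_k 2 (foldr partial_deriv (as @ bs) f)"
    using Cons.prems by (intro C_k_foldr_partial_deriv) (simp del: C_k.simps add: add_ac)
  hence "partial_deriv a (partial_deriv i (foldr partial_deriv (as @ bs) f))
       = partial_deriv i (partial_deriv a (foldr partial_deriv (as @ bs) f))"
    by (rule partial_deriv_commute)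
  moreover have "foldr partial_deriv (as @ i # bs) f = foldr partial_deriv (i # as @ bs) f"
    by (rule Cons.IH, rule C_k_mono[OF Cons.prems]) simp
  ultimately show ?case by simp
qed simp

lemma foldr_partial_deriv_perm:
  assumes "C_k (length ks) f" "mset ks = mset js"
  shows "foldr partial_deriv ks f = foldr partial_deriv js f"
  using assms
proof (induction ks arbitrary: js)
  case (Cons i ks)
  have "i \<in> set js" using Cons.prems(2) by (metis list.set_intros(1) set_mset_mset)
  then obtain as bs where js: "js = as @ i # bs" by (meson split_list)
  have ms: "mset ks = mset (as @ bs)" using Cons.prems(2) by (simp add: js)
  have len: "length ks = length as + length bs" using mset_eq_length[OF ms] by simp
  have "foldr partial_deriv ks f = foldr partial_deriv (as @ bs) f"
    by (rule Cons.IH[OF _ ms], rule C_k_mono[OF Cons.prems(1)]) simp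
  moreover have "foldr partial_deriv js f = foldr partial_deriv (i # as @ bs) f"
    unfolding js using Cons.prems(1) len
    by (intro foldr_partial_deriv_move_front) (simp del: C_k.simps)
  ultimately show ?case by simp
qed simp

text \<open>Derivatives taken along an explicit word of coordinates are convenient for the chain rule,
  whereas the seminorms only see one arbitrarily chosen word per multi-index. Symmetry of partial
  derivatives makes the choice irrelevant.\<close>

lemma foldr_partial_deriv_eq_mi_deriv:
  assumes "C_k (length ks) f"
  shows "foldr partial_deriv ks f = mi_deriv (count_list ks) f"
proof -
  define js where "js = (SOME js. \<forall>i. count_list js i = count_list ks i)"
  have "\<forall>i. count_list js i = count_list ks i"
    unfolding js_def by (rule someI[of _ ks]) simp
  hence "mset ks = mset js" by (simp add: multiset_eq_iff count_mset)
  thus ?thesis using foldr_partial_deriv_perm[OF assms] by (simp add: mi_deriv_def js_def)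
qed

lemma mi_size_count_list: "mi_size (count_list ks) = length ks"
  unfolding mi_size_def by (rule sum_count_set) auto

lemma mi_power_count_list: "mi_power (count_list ks) u = (\<Prod>i\<leftarrow>ks. u $ i)"
proof (induction ks)
  case (Cons a ks)
  have "mi_power (count_list (a # ks)) u
      = (\<Prod>i\<in>UNIV. (if i = a then u $ a else 1) * (u $ i) ^ count_list ks i)"
    unfolding mi_power_def by (intro prod.cong) auto
  also have "\<dots> = u $ a * mi_power (count_list ks) u"
    by (simp add: prod.distrib mi_power_def)
  finally show ?case using Cons.IH by (simp del: count_list.simps)
qed (simp add: mi_power_def)

text \<open>For \<open>f\<close> of class \<open>C\<^sup>n\<close>, the \<open>n\<close>-th directional derivative at \<open>z\<close> in direction \<open>u\<close>. Summing over words of coordinates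
  instead of multi-indices makes multinomial coefficients unnecessary, because each multi-index is
  counted as often as it occurs.\<close>

definition taylor_form :: "(real^'d::finite \<Rightarrow> real) \<Rightarrow> nat \<Rightarrow> real^'d \<Rightarrow> real^'d \<Rightarrow> real" where
  "taylor_form f n z u =
     (\<Sum>ks | length ks = n. mi_deriv (count_list ks) f z * mi_power (count_list ks) u)"

lemma finite_index_words: "finite {ks :: 'd::finite list. length ks = n}"
  using finite_lists_length_eq[of "UNIV :: 'd set" n] by simp

lemma sum_index_words_Suc:
  fixes F :: "'d::finite list \<Rightarrow> real"
  shows "(\<Sum>ks | length ks = Suc n. F ks) = (\<Sum>ks | length ks = n. \<Sum>i\<in>UNIV. F (i # ks))"
proof -
  have "{ks :: 'd list. length ks = Suc n} = (\<lambda>(ks, i). i # ks) ` ({ks. length ks = n} \<times> UNIV)"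
    by (auto simp: length_Suc_conv)
  moreover have "inj_on (\<lambda>(ks, i :: 'd). i # ks) ({ks. length ks = n} \<times> UNIV)"
    by (auto intro: inj_onI)
  ultimately show ?thesis by (simp add: sum.reindex sum.cartesian_product case_prod_unfold)
qed

lemma taylor_form_has_derivative:
  fixes f :: "real^'d::finite \<Rightarrow> real"
  assumes "C_k (Suc n) f"
  shows "((\<lambda>t. taylor_form f n (x + t *\<^sub>R u) u) has_real_derivative
           taylor_form f (Suc n) (x + t *\<^sub>R u) u) (at t)"
proof -
  have diff: "foldr partial_deriv ks f differentiable_on UNIV" if "length ks = n" for ks
    using C_k_foldr_partial_deriv[of ks 1 f] assms that by (simp del: C_k.simps) simp
  have eq: "foldr partial_deriv ks f = mi_deriv (count_list ks) f" if "length ks \<le> Suc n" for ks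
    using that C_k_mono[OF assms] by (intro foldr_partial_deriv_eq_mi_deriv) blast
  have "((\<lambda>t. \<Sum>ks | length ks = n. foldr partial_deriv ks f (x + t *\<^sub>R u) * mi_power (count_list ks) u)
     has_real_derivative (\<Sum>ks | length ks = n. (\<Sum>i\<in>UNIV. partial_deriv i (foldr partial_deriv ks f) (x + t *\<^sub>R u) * u $ i)
            * mi_power (count_list ks) u)) (at t)"
    using diff by (intro DERIV_sum DERIV_cmult_right has_derivative_along_line) auto
  also have "(\<Sum>ks | length ks = n. (\<Sum>i\<in>UNIV. partial_deriv i (foldr partial_deriv ks f) (x + t *\<^sub>R u) * u $ i)
            * mi_power (count_list ks) u)
      = (\<Sum>ks | length ks = n. \<Sum>i\<in>UNIV. mi_deriv (count_list (i # ks)) f (x + t *\<^sub>R u) * mi_power (count_list (i # ks)) u)"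
  proof (intro sum.cong refl)
    fix ks :: "'d list" assume "ks \<in> {ks. length ks = n}"
    hence "foldr partial_deriv (i # ks) f = mi_deriv (count_list (i # ks)) f" for i by (intro eq) simp
    thus "(\<Sum>i\<in>UNIV. partial_deriv i (foldr partial_deriv ks f) (x + t *\<^sub>R u) * u $ i) * mi_power (count_list ks) u
       = (\<Sum>i\<in>UNIV. mi_deriv (count_list (i # ks)) f (x + t *\<^sub>R u) * mi_power (count_list (i # ks)) u)"
      unfolding mi_power_count_list sum_distrib_right by (intro sum.cong) (auto simp del: count_list.simps)
  qed
  also have "\<dots> = taylor_form f (Suc n) (x + t *\<^sub>R u) u"
    unfolding taylor_form_def sum_index_words_Suc ..
  also have "(\<lambda>t. \<Sum>ks | length ks = n. foldr partial_deriv ks f (x + t *\<^sub>R u) * mi_power (count_list ks) u)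
       = (\<lambda>t. taylor_form f n (x + t *\<^sub>R u) u)"
    unfolding taylor_form_def by (intro ext sum.cong) (auto simp: eq)
  finally show ?thesis .
qed

lemma taylor_form_0: "taylor_form f 0 z u = f z"
proof -
  have "(SOME ks. \<forall>i::'a. count_list ks i = count_list [] i) = []"
    by (rule some_equality) (auto simp: count_list_0_iff)
  hence "mi_deriv (count_list []) f = f" by (simp only: mi_deriv_def foldr.simps id_apply)
  thus ?thesis by (simp add: taylor_form_def mi_power_count_list del: count_list.simps)
qed

lemma taylor_along_segment:
  fixes f :: "real^'d::finite \<Rightarrow> real"
  assumes "C_k n f" "n > 0"
  obtains \<theta> where "0 < \<theta>" "\<theta> < 1"
    "f (x + u) = (\<Sum>l<n. taylor_form f l x u / fact l) + taylor_form f n (x + \<theta> *\<^sub>R u) u / fact n"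
proof -
  have "\<exists>t. 0 < t \<and> t < (1::real) \<and> f (x + 1 *\<^sub>R u) =
     (\<Sum>l<n. taylor_form f l (x + 0 *\<^sub>R u) u / fact l * 1 ^ l) + taylor_form f n (x + t *\<^sub>R u) u / fact n * 1 ^ n"
  proof (rule Maclaurin[of 1 n "\<lambda>l t. taylor_form f l (x + t *\<^sub>R u) u" "\<lambda>t. f (x + t *\<^sub>R u)", simplified taylor_form_0])
    show "\<forall>m t. m < n \<and> 0 \<le> t \<and> t \<le> 1 \<longrightarrow> ((\<lambda>t. taylor_form f m (x + t *\<^sub>R u) u)
      has_real_derivative taylor_form f (Suc m) (x + t *\<^sub>R u) u) (at t)"
      using assms(1) C_k_mono taylor_form_has_derivative Suc_leI by blast
  qed (use assms in auto)
  thus ?thesis using that by auto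
qed

lemma taylor_form_in_polys: "taylor_form f n z \<in> polys n"
proof -
  have "(\<lambda>u. taylor_form f n z u) \<in> polys n" unfolding taylor_form_def
    by (intro polys_sum polys_cmult mi_power_in_polys) (simp add: mi_size_count_list)
  thus ?thesis by simp
qed

section \<open>Pointwise values and Sobolev seminorms\<close>

text \<open>If a continuous function exceeded its essential supremum at a point of an open set, it would do so
  on a non-empty open subset, which is not a null set.\<close>

lemma abs_le_Linf_norm:
  fixes g :: "real^'d::finite \<Rightarrow> real"
  assumes g: "continuous_on UNIV g" and y: "y \<in> \<Omega>" and \<Omega>: "open \<Omega>"
  shows "ereal \<bar>g y\<bar> \<le> Linf_norm \<Omega> g"
proof (rule ccontr)
  assume "\<not> ?thesis"
  then obtain c where c: "Linf_norm \<Omega> g < ereal c" "ereal c < ereal \<bar>g y\<bar>"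
    using ereal_dense2 not_le by metis
  let ?U = "{z. c < \<bar>g z\<bar>} \<inter> \<Omega>"
  have "open ?U" using g \<Omega> by (intro open_Int open_Collect_less continuous_intros) auto
  moreover have "y \<in> ?U" using c y by auto
  ultimately have "\<not> negligible ?U" using open_not_negligible by blast
  moreover have "negligible ?U"
  proof -
    have "AE z in lebesgue_on \<Omega>. ereal \<bar>g z\<bar> \<le> Linf_norm \<Omega> g"
      unfolding Linf_norm_def by (rule esssup_AE)
    hence "AE z in lebesgue. z \<in> \<Omega> \<longrightarrow> ereal \<bar>g z\<bar> \<le> Linf_norm \<Omega> g"
      using \<Omega> by (subst (asm) AE_restrict_space_iff) auto
    hence "AE z in lebesgue. z \<notin> ?U"
    proof (rule AE_mp, intro AE_I2 impI notI)
      fix z assume "z \<in> \<Omega> \<longrightarrow> ereal \<bar>g z\<bar> \<le> Linf_norm \<Omega> g" "z \<in> ?U"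
      hence "ereal \<bar>g z\<bar> \<le> Linf_norm \<Omega> g" by blast
      hence "ereal \<bar>g z\<bar> < ereal c" using c(1) by (rule le_less_trans)
      thus False using \<open>z \<in> ?U\<close> by simp
    qed
    hence "?U \<in> null_sets lebesgue"
      by (rule iffD2[OF AE_iff_null_sets[OF sets_completionI_sets[OF lborelD[OF borel_open[OF \<open>open ?U\<close>]]]]])
    thus ?thesis by (simp add: negligible_iff_null_sets)
  qed
  ultimately show False by contradiction
qed

lemma continuous_on_mi_deriv:
  fixes f :: "real^'d::finite \<Rightarrow> real"
  assumes "C_k n f" "length ks \<le> n"
  shows "continuous_on UNIV (mi_deriv (count_list ks) f)"
proof -
  have "C_k (length ks + 0) f" using C_k_mono[OF assms] by simp
  hence "C_k 0 (foldr partial_deriv ks f)" by (rule C_k_foldr_partial_deriv)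
  thus ?thesis using foldr_partial_deriv_eq_mi_deriv[of ks f] C_k_mono[OF assms] by simp
qed

lemma abs_mi_deriv_le_W_seminorm:
  fixes f :: "real^'d::finite \<Rightarrow> real"
  assumes "C_k n f" "length ks \<le> n" "y \<in> \<Omega>" "open \<Omega>"
  shows "ereal \<bar>mi_deriv (count_list ks) f y\<bar> \<le> W_seminorm (length ks) \<Omega> f"
proof -
  have "finite {\<alpha> :: 'd \<Rightarrow> nat. mi_size \<alpha> = length ks}"
    by (rule finite_subset[OF _ finite_multiindices_le[of "length ks"]]) auto
  hence "Linf_norm \<Omega> (mi_deriv (count_list ks) f) \<le> W_seminorm (length ks) \<Omega> f"
    unfolding W_seminorm_def by (intro Max_ge) (auto simp: mi_size_count_list)
  with abs_le_Linf_norm[OF continuous_on_mi_deriv[OF assms(1,2)] assms(3,4)] show ?thesis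
    by (rule order_trans)
qed

lemma W_seminorm_le_W_seminorm2:
  assumes "j \<le> l" "l \<le> n"
  shows "W_seminorm l \<Omega> (f :: real^'d::finite \<Rightarrow> real) \<le> W_seminorm2 j n \<Omega> f"
proof -
  have "mi_size (\<lambda>i. if i = undefined then l else 0 :: nat) = l" 
    by (simp add: mi_size_def)
  hence "{\<alpha> :: 'd \<Rightarrow> nat. mi_size \<alpha> = l} \<noteq> {}" by blast
  moreover have "finite {\<alpha> :: 'd \<Rightarrow> nat. j \<le> mi_size \<alpha> \<and> mi_size \<alpha> \<le> n}"
    by (rule finite_subset[OF _ finite_multiindices_le[of n]]) auto
  ultimately show ?thesis
    unfolding W_seminorm_def W_seminorm2_def using assms by (intro Max_mono) auto
qed

section \<open>The moving least-squares weights\<close>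

lemma infsum_eq_sum_active:
  assumes "finite (active \<Phi> \<nu> y)" "\<And>q. \<Phi> (rel_node \<nu> y q) = 0 \<Longrightarrow> F q = 0"
  shows "(\<Sum>\<^sub>\<infinity>q\<in>UNIV. F q) = (\<Sum>q\<in>active \<Phi> \<nu> y. F q)"
proof -
  have "(\<Sum>\<^sub>\<infinity>q\<in>UNIV. F q) = (\<Sum>\<^sub>\<infinity>q\<in>active \<Phi> \<nu> y. F q)"
    by (rule infsum_cong_neutral) (use assms(2) in \<open>auto simp: active_def\<close>)
  thus ?thesis using assms(1) by simp
qed

lemma positive_definite_mult_matrix_inv:
  assumes "positive_definite A" shows "A *v (matrix_inv A *v b) = b"
proof -
  have "\<forall>v. A *v v = 0 \<longrightarrow> v = 0"
    using assms unfolding positive_definite_def by (metis inner_zero_right less_irrefl)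
  hence "invertible A" by (simp add: invertible_left_inverse matrix_left_invertible_ker)
  hence "A ** matrix_inv A = mat 1"
    unfolding invertible_def matrix_inv_def by (rule someI2_ex) simp
  thus ?thesis by (simp add: matrix_vector_mul_assoc)
qed

lemma scaled_node_eq_rel_node:
  assumes "h > 0" "\<nu> > 0"
  shows "(x - grid_pt h q) /\<^sub>R (\<nu> * h) = rel_node \<nu> (x /\<^sub>R h) q"
  using assms by (simp add: rel_node_def grid_pt_def vec_eq_iff field_simps)

text \<open>The polynomial is \<open>s = \<Sum>j. \<lambda>\<^sub>j * p\<^sub>j\<close>. Row \<open>i\<close> of the linear system \<open>A \<lambda> = (p\<^sub>1(0), \<dots>, p\<^sub>M(0))\<close> says
  precisely that the weights reproduce the basis polynomial \<open>p\<^sub>i\<close>.\<close>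

lemma mls_weights_reproducing:
  fixes \<Phi> :: "real^'d::finite \<Rightarrow> real" and p :: "'b::finite \<Rightarrow> real^'d \<Rightarrow> real"
  assumes basis: "poly_basis r p" and h: "h > 0" and \<nu>: "\<nu> > 0"
    and supp: "\<And>z. \<Phi> z \<noteq> 0 \<Longrightarrow> norm z \<le> 1"
    and pd: "positive_definite (shape_matrix \<Phi> p h (\<nu> * h) x)"
  obtains s where "reproducing r \<Phi> \<nu> (x /\<^sub>R h) s"
    "\<And>q. mls_weight \<Phi> p h (\<nu> * h) (grid_pt h q) x
        = \<Phi> (rel_node \<nu> (x /\<^sub>R h) q) * s (rel_node \<nu> (x /\<^sub>R h) q)"
proof -
  let ?A = "active \<Phi> \<nu> (x /\<^sub>R h)" and ?\<xi> = "rel_node \<nu> (x /\<^sub>R h)"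
  let ?c = "mls_coeff \<Phi> p h (\<nu> * h) x"
  define s where "s z = (\<Sum>j\<in>UNIV. ?c $ j * p j z)" for z
  have fin: "finite ?A" using supp \<nu> by (rule finite_active)
  have pj: "(\<Sum>q\<in>?A. \<Phi> (?\<xi> q) * s (?\<xi> q) * p i (?\<xi> q)) = p i 0" for i
  proof -
    have a: "shape_matrix \<Phi> p h (\<nu> * h) x $ i $ j
        = (\<Sum>q\<in>?A. \<Phi> (?\<xi> q) * p i (?\<xi> q) * p j (?\<xi> q))" for j
      unfolding shape_matrix_def scaled_node_eq_rel_node[OF h \<nu>] vec_lambda_beta
      by (rule infsum_eq_sum_active[OF fin]) simp
    have "(\<Sum>q\<in>?A. \<Phi> (?\<xi> q) * s (?\<xi> q) * p i (?\<xi> q))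
        = (\<Sum>q\<in>?A. \<Sum>j\<in>UNIV. \<Phi> (?\<xi> q) * p i (?\<xi> q) * p j (?\<xi> q) * ?c $ j)"
      by (simp add: s_def sum_distrib_left sum_distrib_right mult_ac)
    also have "\<dots> = (\<Sum>j\<in>UNIV. shape_matrix \<Phi> p h (\<nu> * h) x $ i $ j * ?c $ j)"
      by (subst sum.swap) (simp add: a sum_distrib_right)
    also have "\<dots> = (shape_matrix \<Phi> p h (\<nu> * h) x *v ?c) $ i"
      by (simp add: matrix_vector_mult_def)
    also have "\<dots> = p i 0"
      unfolding mls_coeff_def positive_definite_mult_matrix_inv[OF pd] by simp
    finally show ?thesis .
  qed
  have "(\<Sum>q\<in>?A. \<Phi> (?\<xi> q) * s (?\<xi> q) * g (?\<xi> q)) = g 0" if g: "g \<in> polys r" for g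
  proof -
    obtain a where a: "g = (\<lambda>z. \<Sum>i\<in>UNIV. a i * p i z)"
      using poly_basis_expansion[OF basis g] by blast
    have "(\<Sum>q\<in>?A. \<Phi> (?\<xi> q) * s (?\<xi> q) * g (?\<xi> q))
        = (\<Sum>q\<in>?A. \<Sum>i\<in>UNIV. a i * (\<Phi> (?\<xi> q) * s (?\<xi> q) * p i (?\<xi> q)))"
      unfolding a sum_distrib_left by (intro sum.cong refl) (rule mult.left_commute)
    also have "\<dots> = (\<Sum>i\<in>UNIV. a i * (\<Sum>q\<in>?A. \<Phi> (?\<xi> q) * s (?\<xi> q) * p i (?\<xi> q)))"
      unfolding sum_distrib_left by (rule sum.swap)
    finally show ?thesis by (simp add: pj a)
  qed
  moreover have "s \<in> polys r" unfolding s_def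
    using basis by (intro polys_sum polys_cmult) (auto simp: poly_basis_def)
  ultimately have "reproducing r \<Phi> \<nu> (x /\<^sub>R h) s" by (simp add: reproducing_def)
  thus ?thesis
    by (rule that) (simp only: mls_weight_def s_def scaled_node_eq_rel_node[OF h \<nu>])
qed

lemma mls_kernel_continuous:
  assumes "mls_kernel m \<Phi>" shows "continuous_on UNIV \<Phi>"
  using assms C_k_mono[of m \<Phi> 0] by (simp add: mls_kernel_def)

text \<open>The set where \<open>\<Phi> \<noteq> 0\<close> is open, so it lies in the interior of the closed unit ball. Grid points with
  non-zero weight are therefore in the open ball of radius \<open>\<delta>\<close>, over which the seminorms are
  taken.\<close>

lemma mls_kernel_support:
  fixes \<Phi> :: "real^'d::finite \<Rightarrow> real"
  assumes "mls_kernel m \<Phi>" "\<Phi> z \<noteq> 0" shows "norm z < 1"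
proof -
  have "closure {z. \<Phi> z \<noteq> 0} \<subseteq> cball 0 1" using assms(1) by (simp add: mls_kernel_def)
  with closure_subset have "{z. \<Phi> z \<noteq> 0} \<subseteq> cball 0 1" by (rule order_trans)
  moreover have "open {z. \<Phi> z \<noteq> 0}"
    using mls_kernel_continuous[OF assms(1)] by (intro open_Collect_neq) auto
  ultimately have "{z. \<Phi> z \<noteq> 0} \<subseteq> interior (cball 0 1)" by (rule interior_maximal)
  thus ?thesis using assms(2) by auto
qed

section \<open>The error estimate\<close>

lemma mi_power_minus: "mi_power \<alpha> (- u) = (- 1) ^ mi_size \<alpha> * mi_power \<alpha> u"
proof -
  have "mi_power \<alpha> (- u) = (\<Prod>i\<in>UNIV. (- 1) ^ \<alpha> i * (u $ i) ^ \<alpha> i)"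
    unfolding mi_power_def by (intro prod.cong) (simp_all add: power_minus[of "u $ _"])
  thus ?thesis by (simp add: prod.distrib mi_power_def mi_size_def power_sum)
qed

lemma abs_mi_power_le: "\<bar>mi_power \<alpha> u\<bar> \<le> norm u ^ mi_size \<alpha>"
proof -
  have "\<bar>mi_power \<alpha> u\<bar> = (\<Prod>i\<in>UNIV. \<bar>u $ i\<bar> ^ \<alpha> i)"
    by (simp add: mi_power_def abs_prod power_abs)
  also have "\<dots> \<le> (\<Prod>i\<in>UNIV. norm u ^ \<alpha> i)"
    by (intro prod_mono) (simp add: power_mono component_le_norm_cart)
  finally show ?thesis by (simp add: mi_size_def power_sum)
qed

lemma taylor_form_Suc_0: "taylor_form f (Suc n) z 0 = 0"
  unfolding taylor_form_def
  by (intro sum.neutral) (auto simp: mi_power_count_list length_Suc_conv simp del: count_list.simps)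

lemma abs_divide_fact_le: "\<bar>a / fact n\<bar> \<le> \<bar>a :: real\<bar>"
  using mult_left_mono[OF fact_ge_1, of "\<bar>a\<bar>" n] by (simp add: abs_divide divide_le_eq)

text \<open>Here \<open>L\<close> bounds the Lebesgue constant at \<open>x\<close>, \<open>M\<close> the moments of order \<open>r + 1\<close>, and \<open>B1\<close>, \<open>B2\<close> the
  derivatives of orders \<open>r + 1\<close> and \<open>r + 2\<close>. The part \<open>T\<close> of degree at most \<open>r\<close> of the Taylor expansion
  is reproduced and yields \<open>T 0 = f x\<close>, so only the other two parts remain. The factorials are
  at least \<open>1\<close> and are dropped.\<close>

lemma mls_error_bound:
  fixes \<Phi> :: "real^'d::finite \<Rightarrow> real" and p :: "'b::finite \<Rightarrow> real^'d \<Rightarrow> real"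
  assumes \<Phi>: "mls_kernel m \<Phi>" and basis: "poly_basis r p" and h: "h > 0" and \<nu>: "\<nu> > 0"
    and pd: "positive_definite (shape_matrix \<Phi> p h (\<nu> * h) x)"
    and r: "even r" and f: "C_k (r + 2) f"
    and L: "\<And>s. reproducing r \<Phi> \<nu> (x /\<^sub>R h) s \<Longrightarrow>
      (\<Sum>q\<in>active \<Phi> \<nu> (x /\<^sub>R h). \<bar>\<Phi> (rel_node \<nu> (x /\<^sub>R h) q) * s (rel_node \<nu> (x /\<^sub>R h) q)\<bar>) \<le> L"
    and M: "\<And>ks. length ks = r + 1 \<Longrightarrow>
      \<bar>\<Sum>\<^sub>\<infinity>q\<in>UNIV. mls_weight \<Phi> p h (\<nu> * h) (grid_pt h q) x * mi_power (count_list ks) (x - grid_pt h q)\<bar> \<le> M"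
    and B1: "\<And>ks. length ks = r + 1 \<Longrightarrow> \<bar>mi_deriv (count_list ks) f x\<bar> \<le> B1"
    and B2: "\<And>ks y. length ks = r + 2 \<Longrightarrow> y \<in> ball x (\<nu> * h) \<Longrightarrow> \<bar>mi_deriv (count_list ks) f y\<bar> \<le> B2"
  shows "\<bar>mls_error \<Phi> p h (\<nu> * h) f x\<bar> \<le>
     real (card {ks :: 'd list. length ks = r + 1}) * (B1 * M)
     + L * (real (card {ks :: 'd list. length ks = r + 2}) * (B2 * (\<nu> * h) ^ (r + 2)))"
proof -
  define \<delta> where "\<delta> = \<nu> * h"
  have \<delta>: "\<delta> > 0" using h \<nu> by (simp add: \<delta>_def)
  let ?A = "active \<Phi> \<nu> (x /\<^sub>R h)" and ?\<xi> = "rel_node \<nu> (x /\<^sub>R h)"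
  have supp: "norm z \<le> 1" if "\<Phi> z \<noteq> 0" for z using mls_kernel_support[OF \<Phi> that] by simp
  have fin: "finite ?A" using supp \<nu> by (rule finite_active)
  obtain s where s: "reproducing r \<Phi> \<nu> (x /\<^sub>R h) s"
    and w_eq: "\<And>q. mls_weight \<Phi> p h \<delta> (grid_pt h q) x = \<Phi> (?\<xi> q) * s (?\<xi> q)"
    using mls_weights_reproducing[OF basis h \<nu> supp pd] unfolding \<delta>_def by blast
  define w where "w q = \<Phi> (?\<xi> q) * s (?\<xi> q)" for q
  define u where "u q = - (\<delta> *\<^sub>R ?\<xi> q)" for q
  have u: "grid_pt h q = x + u q" for q
    using h \<nu> by (simp add: u_def \<delta>_def rel_node_def grid_pt_def vec_eq_iff field_simps)
  define T where "T v = (\<Sum>l<Suc r. taylor_form f l x v / fact l)" for v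
  define Rem where "Rem v = f (x + v) - T v - taylor_form f (r + 1) x v / fact (r + 1)" for v
  have approx: "mls_approx \<Phi> p h \<delta> f x = (\<Sum>q\<in>?A. w q * f (x + u q))"
    unfolding mls_approx_def w_eq u[symmetric] w_def by (rule infsum_eq_sum_active[OF fin]) simp
  have T0: "T 0 = f x"
    unfolding T_def sum.lessThan_Suc_shift by (simp add: taylor_form_0 taylor_form_Suc_0)
  have "T \<in> polys r"
  proof -
    have "(\<lambda>v. \<Sum>l<Suc r. 1 / fact l * taylor_form f l x v) \<in> polys r"
      by (intro polys_sum polys_cmult polys_mono[OF taylor_form_in_polys]) simp
    thus ?thesis by (simp add: T_def[abs_def])
  qed
  hence "(\<lambda>z. T (0 + (- \<delta>) *\<^sub>R z)) \<in> polys r" by (rule polys_affine)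
  hence main: "(\<Sum>q\<in>?A. w q * T (u q)) = f x"
    using s T0 unfolding reproducing_def w_def u_def by fastforce
  have odd_part: "\<bar>\<Sum>q\<in>?A. w q * taylor_form f (r + 1) x (u q)\<bar>
       \<le> real (card {ks :: 'd list. length ks = r + 1}) * (B1 * M)"
  proof -
    let ?mom = "\<lambda>ks. \<Sum>q\<in>?A. w q * mi_power (count_list ks) (x - grid_pt h q)"
    have mom: "\<bar>?mom ks\<bar> \<le> M" if "length ks = r + 1" for ks
    proof -
      have "(\<Sum>\<^sub>\<infinity>q\<in>UNIV. w q * mi_power (count_list ks) (x - grid_pt h q)) = ?mom ks"
        by (rule infsum_eq_sum_active[OF fin]) (simp add: w_def)
      thus ?thesis using M[OF that] unfolding \<delta>_def[symmetric] w_eq w_def[symmetric] by simp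
    qed
    have B10: "0 \<le> B1" using B1[of "replicate (r + 1) undefined"] by force
    have "(\<Sum>q\<in>?A. w q * taylor_form f (r + 1) x (u q))
        = (\<Sum>q\<in>?A. \<Sum>ks | length ks = r + 1. - (mi_deriv (count_list ks) f x * (w q * mi_power (count_list ks) (x - grid_pt h q))))"
      unfolding taylor_form_def sum_distrib_left
    proof (intro sum.cong refl)
      fix q and ks :: "'d list" assume "ks \<in> {ks. length ks = r + 1}"
      \<comment> \<open>The moments use \<open>x - hq\<close>, the Taylor expansion \<open>hq - x\<close>; the sign is \<open>- 1\<close> as \<open>r + 1\<close> is odd.\<close>
      hence "mi_power (count_list ks) (u q) = - mi_power (count_list ks) (x - grid_pt h q)"
        using mi_power_minus[of "count_list ks" "x - grid_pt h q"] r
        by (simp add: mi_size_count_list u)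
      thus "w q * (mi_deriv (count_list ks) f x * mi_power (count_list ks) (u q))
          = - (mi_deriv (count_list ks) f x * (w q * mi_power (count_list ks) (x - grid_pt h q)))"
        by simp
    qed
    also have "\<dots> = - (\<Sum>ks | length ks = r + 1. mi_deriv (count_list ks) f x * ?mom ks)"
      by (subst sum.swap) (simp add: sum_negf sum_distrib_left)
    finally have "\<bar>\<Sum>q\<in>?A. w q * taylor_form f (r + 1) x (u q)\<bar>
        \<le> (\<Sum>ks | length ks = r + 1. \<bar>mi_deriv (count_list ks) f x * ?mom ks\<bar>)"
      by (simp add: sum_abs)
    also have "\<dots> \<le> (\<Sum>ks\<in>{ks :: 'd list. length ks = r + 1}. B1 * M)"
      unfolding abs_mult using B1 mom B10 by (intro sum_mono mult_mono) auto
    finally show ?thesis by simp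
  qed
  have rem: "\<bar>Rem (u q)\<bar> \<le> real (card {ks :: 'd list. length ks = r + 2}) * (B2 * \<delta> ^ (r + 2))"
    if q: "q \<in> ?A" for q
  proof -
    obtain \<theta> where \<theta>: "0 < \<theta>" "\<theta> < 1"
      "f (x + u q) = (\<Sum>l<r + 2. taylor_form f l x (u q) / fact l) + taylor_form f (r + 2) (x + \<theta> *\<^sub>R u q) (u q) / fact (r + 2)"
      using taylor_along_segment[OF f, of x "u q"] by auto
    have "norm (?\<xi> q) < 1" using q mls_kernel_support[OF \<Phi>] by (auto simp: active_def)
    hence nu: "norm (u q) < \<delta>" using \<delta> by (simp add: u_def)
    have "\<theta> * norm (u q) \<le> norm (u q)" using \<theta> by (simp add: mult_left_le_one_le)
    hence inb: "x + \<theta> *\<^sub>R u q \<in> ball x (\<nu> * h)" using nu \<theta> by (simp add: dist_norm \<delta>_def)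
    have "Rem (u q) = taylor_form f (r + 2) (x + \<theta> *\<^sub>R u q) (u q) / fact (r + 2)"
      using \<theta>(3) by (simp add: Rem_def T_def)
    hence "\<bar>Rem (u q)\<bar> \<le> \<bar>taylor_form f (r + 2) (x + \<theta> *\<^sub>R u q) (u q)\<bar>"
      by (simp only: abs_divide_fact_le)
    also have "\<dots> \<le> (\<Sum>ks | length ks = r + 2. \<bar>mi_deriv (count_list ks) f (x + \<theta> *\<^sub>R u q) * mi_power (count_list ks) (u q)\<bar>)"
      unfolding taylor_form_def by (rule sum_abs)
    also have "\<dots> \<le> (\<Sum>ks\<in>{ks :: 'd list. length ks = r + 2}. B2 * \<delta> ^ (r + 2))"
    proof (rule sum_mono)
      fix ks :: "'d list" assume "ks \<in> {ks. length ks = r + 2}"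
      hence len: "length ks = r + 2" by simp
      have "\<bar>mi_power (count_list ks) (u q)\<bar> \<le> norm (u q) ^ (r + 2)"
        using abs_mi_power_le[of "count_list ks" "u q"] by (simp only: mi_size_count_list len)
      also have "\<dots> \<le> \<delta> ^ (r + 2)" using nu by (intro power_mono) auto
      finally show "\<bar>mi_deriv (count_list ks) f (x + \<theta> *\<^sub>R u q) * mi_power (count_list ks) (u q)\<bar> \<le> B2 * \<delta> ^ (r + 2)"
        unfolding abs_mult using B2[OF len inb] by (intro mult_mono) auto
    qed
    finally show ?thesis by simp
  qed
  let ?N2 = "real (card {ks :: 'd list. length ks = r + 2})"
  have B20: "0 \<le> B2" using B2[of "replicate (r + 2) undefined" x] h \<nu> by force
  have "\<bar>\<Sum>q\<in>?A. w q * Rem (u q)\<bar> \<le> (\<Sum>q\<in>?A. \<bar>w q\<bar> * (?N2 * (B2 * \<delta> ^ (r + 2))))"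
    using rem by (intro order_trans[OF sum_abs] sum_mono) (simp add: abs_mult mult_left_mono)
  also have "\<dots> \<le> L * (?N2 * (B2 * \<delta> ^ (r + 2)))"
    unfolding sum_distrib_right[symmetric] w_def using L[OF s] B20 \<delta> by (intro mult_right_mono) auto
  finally have rem_sum: "\<bar>\<Sum>q\<in>?A. w q * Rem (u q)\<bar> \<le> L * (?N2 * (B2 * \<delta> ^ (r + 2)))" .
  let ?odd = "\<Sum>q\<in>?A. w q * taylor_form f (r + 1) x (u q)"
  have "(\<Sum>q\<in>?A. w q * f (x + u q))
      = (\<Sum>q\<in>?A. w q * T (u q) + w q * taylor_form f (r + 1) x (u q) / fact (r + 1) + w q * Rem (u q))"
    by (intro sum.cong) (auto simp: Rem_def algebra_simps)
  also have "\<dots> = f x + ?odd / fact (r + 1) + (\<Sum>q\<in>?A. w q * Rem (u q))"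
    by (simp only: sum.distrib main sum_divide_distrib)
  finally have "\<bar>mls_error \<Phi> p h \<delta> f x\<bar> \<le> \<bar>?odd / fact (r + 1)\<bar> + \<bar>\<Sum>q\<in>?A. w q * Rem (u q)\<bar>"
    unfolding mls_error_def approx by linarith
  moreover have "\<bar>?odd / fact (r + 1)\<bar> \<le> \<bar>?odd\<bar>" by (rule abs_divide_fact_le)
  ultimately show ?thesis using odd_part rem_sum unfolding \<delta>_def by linarith
qed

theorem theorem2p9:
  fixes \<Phi> :: "real^'d::finite \<Rightarrow> real"
    and r k m :: nat
    and \<nu>\<^sub>0 :: real
  assumes "r < k" and "k < m"
    and "mls_kernel m \<Phi>"
    and "even r"
    and "\<And>x. \<Phi> (- x) = \<Phi> x"
    and "odd_moment_threshold TYPE('d) TYPE('b::finite) r \<nu>\<^sub>0"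
  shows "\<exists>C>0. \<forall>(p :: 'b \<Rightarrow> real^'d \<Rightarrow> real) h \<nu> \<delta> f.
    poly_basis r p \<longrightarrow> 0 < h \<longrightarrow> 1 < \<nu> \<longrightarrow> \<nu>\<^sub>0 \<le> \<nu> \<longrightarrow> \<delta> = \<nu> * h \<longrightarrow>
    (\<forall>x. positive_definite (shape_matrix \<Phi> p h \<delta> x)) \<longrightarrow>
    C_k (r + 2) f \<longrightarrow>
      (\<forall>x. ereal \<bar>mls_error \<Phi> p h \<delta> f x\<bar> \<le>
         ereal C * (ereal (\<nu> powi (1 - int m) * \<delta> ^ (r + 1)) * W_seminorm (r + 1) (ball x \<delta>) f
                    + ereal (\<delta> ^ (r + 2)) * W_seminorm (r + 2) (ball x \<delta>) f)) \<and>
      (\<nu> powi (- int m) \<le> h \<longrightarrow>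
        (\<forall>x. ereal \<bar>mls_error \<Phi> p h \<delta> f x\<bar> \<le>
           ereal (2 * C * \<delta> ^ (r + 2)) * W_seminorm2 (r + 1) (r + 2) (ball x \<delta>) f))"
proof (cases "\<exists>p :: 'b \<Rightarrow> real^'d \<Rightarrow> real. poly_basis r p")
  \<comment> \<open>The index type \<open>'b\<close> has the wrong cardinality for a basis, and there is nothing to bound.\<close>
  case False
  thus ?thesis by (intro exI[of _ 1]) auto
next
  case True
  \<comment> \<open>A reference basis for the Lebesgue constant: the bound must not depend on the basis \<open>p\<close> used
    for the approximation, which is chosen after \<open>C\<close>.\<close>
  then obtain p0 :: "'b \<Rightarrow> real^'d \<Rightarrow> real" where p0: "poly_basis r p0" by blast
  note \<Phi> = \<open>mls_kernel m \<Phi>\<close>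
  have nn: "0 \<le> \<Phi> z" for z using \<Phi> by (simp add: mls_kernel_def)
  obtain z0 where z0: "\<Phi> z0 \<noteq> 0" using \<Phi> by (auto simp: mls_kernel_def)
  have supp: "norm z \<le> 1" if "\<Phi> z \<noteq> 0" for z using mls_kernel_support[OF \<Phi> that] by simp
  have "\<exists>L>0. \<forall>\<nu> y s. 1 < \<nu> \<longrightarrow> reproducing r \<Phi> \<nu> y s \<longrightarrow>
    (\<Sum>q\<in>active \<Phi> \<nu> y. \<bar>\<Phi> (rel_node \<nu> y q) * s (rel_node \<nu> y q)\<bar>) \<le> L"
    by (rule lebesgue_constant_bounded[OF mls_kernel_continuous[OF \<Phi>] nn z0 supp p0]) auto
  then obtain L where L0: "L > 0" and L: "\<And>\<nu> y s. 1 < \<nu> \<Longrightarrow> reproducing r \<Phi> \<nu> y s \<Longrightarrow>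
    (\<Sum>q\<in>active \<Phi> \<nu> y. \<bar>\<Phi> (rel_node \<nu> y q) * s (rel_node \<nu> y q)\<bar>) \<le> L" by meson
  define mom where "mom \<alpha> K \<longleftrightarrow> (\<forall>(p :: 'b \<Rightarrow> real^'d \<Rightarrow> real) h \<nu>.
     poly_basis r p \<longrightarrow> 0 < h \<longrightarrow> 1 < \<nu> \<longrightarrow> \<nu>\<^sub>0 \<le> \<nu> \<longrightarrow>
     (\<forall>x. positive_definite (shape_matrix \<Phi> p h (\<nu> * h) x)) \<longrightarrow>
     (\<forall>x. \<bar>\<Sum>\<^sub>\<infinity>q\<in>UNIV. mls_weight \<Phi> p h (\<nu> * h) (grid_pt h q) x * mi_power \<alpha> (x - grid_pt h q)\<bar>
         \<le> K * (\<nu> * h) ^ mi_size \<alpha> * \<nu> powi (1 - int m)))" for \<alpha> K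
  let ?W1 = "{ks :: 'd list. length ks = r + 1}"
  have "\<exists>K>0. mom \<alpha> K" if "odd (mi_size \<alpha>)" for \<alpha>
    using assms that unfolding odd_moment_threshold_def mom_def by meson
  hence "\<forall>ks\<in>?W1. \<exists>K. K > 0 \<and> mom (count_list ks) K"
    using \<open>even r\<close> by (auto simp: mi_size_count_list simp del: count_list.simps)
  from bchoice[OF this] obtain K where K: "\<And>ks. ks \<in> ?W1 \<Longrightarrow> K ks > 0" "\<And>ks. ks \<in> ?W1 \<Longrightarrow> mom (count_list ks) (K ks)"
    by auto
  define KK where "KK = (\<Sum>ks\<in>?W1. K ks)"
  have K_le: "K ks \<le> KK" if "ks \<in> ?W1" for ks
    unfolding KK_def using that K(1) by (intro member_le_sum finite_index_words) (auto intro: less_imp_le)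
  have KK0: "KK \<ge> 0" unfolding KK_def using K(1) by (intro sum_nonneg) (auto intro: less_imp_le)
  define N where "N n = real (card {ks :: 'd list. length ks = n})" for n
  define C where "C = N (r + 1) * KK + L * N (r + 2) + 1"
  have C: "C > 0" "N (r + 1) * KK \<le> C" "L * N (r + 2) \<le> C"
    using KK0 L0 by (simp_all add: C_def N_def add_nonneg_pos)
  show ?thesis
  proof (rule exI[of _ C], intro conjI C(1) allI impI)
    fix p :: "'b \<Rightarrow> real^'d \<Rightarrow> real" and h \<nu> \<delta> :: real and f :: "real^'d \<Rightarrow> real" and x :: "real^'d"
    assume p: "poly_basis r p" and h: "0 < h" and \<nu>: "1 < \<nu>" "\<nu>\<^sub>0 \<le> \<nu>" and \<delta>: "\<delta> = \<nu> * h"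
      and pd: "\<forall>x. positive_definite (shape_matrix \<Phi> p h \<delta> x)" and f: "C_k (r + 2) f"
    let ?S1 = "W_seminorm (r + 1) (ball x \<delta>) f" and ?S2 = "W_seminorm (r + 2) (ball x \<delta>) f"
    define a where "a = \<nu> powi (1 - int m) * \<delta> ^ (r + 1)"
    define b where "b = \<delta> ^ (r + 2)"
    have \<delta>0: "\<delta> > 0" using h \<nu> by (simp add: \<delta>)
    have ab: "a > 0" "b > 0" using \<delta>0 \<nu> by (simp_all add: a_def b_def)
    have S1: "ereal \<bar>mi_deriv (count_list ks) f y\<bar> \<le> ?S1" if "length ks = r + 1" "y \<in> ball x \<delta>" for ks y
      using abs_mi_deriv_le_W_seminorm[OF f, of ks y "ball x \<delta>"] that by simp
    have S2: "ereal \<bar>mi_deriv (count_list ks) f y\<bar> \<le> ?S2" if "length ks = r + 2" "y \<in> ball x \<delta>" for ks y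
      using abs_mi_deriv_le_W_seminorm[OF f, of ks y "ball x \<delta>"] that by simp
    have "0 \<le> ereal \<bar>mi_deriv (count_list (replicate (r + 1) undefined)) f x\<bar>" by simp
    also have "\<dots> \<le> ?S1" using \<delta>0 by (intro S1) simp_all
    finally have S10: "0 \<le> ?S1" .
    have "0 \<le> ereal \<bar>mi_deriv (count_list (replicate (r + 2) undefined)) f x\<bar>" by simp
    also have "\<dots> \<le> ?S2" using \<delta>0 by (intro S2) simp_all
    finally have S20: "0 \<le> ?S2" .
    \<comment> \<open>Infinite seminorms make the right-hand side infinite, because its coefficients are positive.\<close>
    show first: "ereal \<bar>mls_error \<Phi> p h \<delta> f x\<bar> \<le> ereal C * (ereal a * ?S1 + ereal b * ?S2)"
    proof (cases "?S1 = \<infinity> \<or> ?S2 = \<infinity>")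
      case True
      hence "ereal C * (ereal a * ?S1 + ereal b * ?S2) = \<infinity>"
        using C(1) ab S10 S20 by (cases ?S1; cases ?S2) auto
      thus ?thesis by (simp only: ereal_less_eq)
    next
      case False
      with S10 S20 obtain b1 b2 where bb: "?S1 = ereal b1" "?S2 = ereal b2"
        by (cases ?S1; cases ?S2) auto
      with S10 S20 have b0: "0 \<le> b1" "0 \<le> b2" by auto
      have M: "\<bar>\<Sum>\<^sub>\<infinity>q\<in>UNIV. mls_weight \<Phi> p h (\<nu> * h) (grid_pt h q) x * mi_power (count_list ks) (x - grid_pt h q)\<bar> \<le> KK * a"
        if len: "length ks = r + 1" for ks :: "'d list"
      proof -
        have "\<bar>\<Sum>\<^sub>\<infinity>q\<in>UNIV. mls_weight \<Phi> p h (\<nu> * h) (grid_pt h q) x * mi_power (count_list ks) (x - grid_pt h q)\<bar>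
            \<le> K ks * (\<nu> * h) ^ mi_size (count_list ks) * \<nu> powi (1 - int m)"
          using K(2)[of ks] len p h \<nu> pd unfolding mom_def \<delta> by simp
        also have "\<dots> = K ks * a" by (simp add: mi_size_count_list len a_def \<delta>)
        also have "\<dots> \<le> KK * a" using K_le[of ks] len ab by (intro mult_right_mono) auto
        finally show ?thesis .
      qed
      have "\<bar>mls_error \<Phi> p h (\<nu> * h) f x\<bar> \<le> N (r + 1) * (b1 * (KK * a)) + L * (N (r + 2) * (b2 * (\<nu> * h) ^ (r + 2)))"
        unfolding N_def
      proof (rule mls_error_bound[OF \<Phi> p h _ _ \<open>even r\<close> f])
        show "\<bar>mi_deriv (count_list ks) f x\<bar> \<le> b1" if "length ks = r + 1" for ks
          using S1[OF that, of x] \<delta>0 bb by simp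
        show "\<bar>mi_deriv (count_list ks) f y\<bar> \<le> b2" if "length ks = r + 2" "y \<in> ball x (\<nu> * h)" for ks y
          using S2[OF that(1), of y] that(2) bb \<delta> by simp
      qed (use L M \<nu> pd \<delta> in auto)
      also have "\<dots> = (N (r + 1) * KK) * (a * b1) + (L * N (r + 2)) * (b * b2)"
        by (simp add: b_def \<delta>)
      also have "\<dots> \<le> C * (a * b1) + C * (b * b2)"
        using C ab b0 by (intro add_mono mult_right_mono) auto
      finally show ?thesis unfolding bb \<delta>[symmetric] by (simp add: distrib_left)
    qed
    assume small: "\<nu> powi (- int m) \<le> h"
    let ?S = "W_seminorm2 (r + 1) (r + 2) (ball x \<delta>) f"
    have le: "?S1 \<le> ?S" "?S2 \<le> ?S" by (simp_all add: W_seminorm_le_W_seminorm2)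
    have "a \<le> b"
    proof -
      have "\<nu> powi (1 - int m) = \<nu> * \<nu> powi (- int m)"
        using \<nu> power_int_add[of \<nu> 1 "- int m"] by simp
      also have "\<dots> \<le> \<delta>" using small \<nu> unfolding \<delta> by (intro mult_left_mono) auto
      finally show ?thesis using \<delta>0 by (simp add: a_def b_def mult_right_mono)
    qed
    have "ereal C * (ereal a * ?S1 + ereal b * ?S2) \<le> ereal C * (ereal b * ?S + ereal b * ?S)"
      using C(1) ab \<open>a \<le> b\<close> le S10 by (intro ereal_mult_left_mono add_mono ereal_mult_mono) auto
    also have "\<dots> = ereal (2 * C * b) * ?S"
      using C(1) ab order_trans[OF S10 le(1)] by (cases ?S) (auto simp: algebra_simps)
    finally show "ereal \<bar>mls_error \<Phi> p h \<delta> f x\<bar> \<le> ereal (2 * C * b) * ?S"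
      using first by (rule order_trans[rotated])
  qed
qed

end
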